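(* For $|q|<1$, the following three identities hold: $$\sum_{n=0}^{\infty} \Bigl( \sum_{d \mid 3n+2} d \Bigr) q^{n} = \frac{3\,(q^{3};q^{3})_{\infty}^{6}}{(q;q)_{\infty}^{2}},$$ $$\sum_{n=0}^{\infty}\Bigl(\sum_{d\mid 3n+1} \left(\frac{d}{3}\right)\Bigr) q^{n} = \frac{(q^{3};q^{3})_{\infty}^{3}}{(q;q)_{\infty}}, \qquad \text{and} \qquad \sum_{n=0}^{\infty}\Bigl(\sum_{d\mid 3n+2} \left(\frac{d}{3}\right)\Bigr) q^{n} = 0,$$ where the inner sums run over positive divisors.
   Context: $\left(\frac{\cdot}{3}\right)$ is the Jacobi (Legendre) symbol modulo $3$. For $|q|<1$, $(q;q)_\infty=\prod_{n=1}^{\infty}(1-q^n)$ and $(q^3;q^3)_\infty=\prod_{n=1}^\infty (1-q^{3n})$. *)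

theory Defs
  imports "HOL-Analysis.Analysis" "HOL-Number_Theory.Residues"
begin

text \<open>The product \<open>(x;x)\<^sub>\<infinity>\<close>, whose factors \<open>1 - x ^ m\<close> run over \<open>m \<ge> 1\<close>. In particular
  \<open>(q\<^sup>3;q\<^sup>3)\<^sub>\<infinity>\<close> is \<open>qq_inf (q ^ 3)\<close>.\<close>

definition qq_inf :: "complex \<Rightarrow> complex" where
  "qq_inf x = (\<Prod>n. 1 - x ^ Suc n)"

text \<open>\<^const>\<open>prodinf\<close> is unspecified for divergent products; on the open unit disc this does not
  occur.\<close>

lemma has_prod_qq_inf:
  assumes "norm x < 1"
  shows "(\<lambda>n. 1 - x ^ Suc n) has_prod qq_inf x"
proof -
  have "summable (\<lambda>n. norm (x ^ Suc n))"
    unfolding norm_power using assms by (subst summable_Suc_iff) (simp add: summable_geometric)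
  then have "abs_convergent_prod (\<lambda>n. 1 - x ^ Suc n)"
    by (subst abs_convergent_prod_conv_summable) simp
  then show ?thesis
    unfolding qq_inf_def
    using abs_convergent_prod_imp_convergent_prod convergent_prod_has_prod by blast
qed

end

theory Submission
  imports Defs "HOL-Computational_Algebra.Polynomial"
begin

text \<open>Everything rests on the bilateral Lambert series
\<open>s = \<Sum>n\<in>\<int>. q\<^sup>n / (1 - q\<^bsup>3n+1\<^esup>)\<close>.

Expanding its terms into geometric series, the indices \<open>n \<ge> 0\<close> contribute \<open>q\<^sup>N\<close> for every
factorisation \<open>3N+1 = (3n+1)(3m+1)\<close>, and the indices \<open>n < 0\<close> contribute \<open>- q\<^sup>N\<close> for every factorisation
\<open>3N+1 = (3n+2)(3m+2)\<close>. So \<open>s\<close> is the generating function of the divisor sums of the Legendre symbol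
over the numbers \<open>3N+1\<close>. The second identity therefore says that \<open>s\<close> equals the quotient
\<open>(q\<^sup>3;q\<^sup>3)\<^sub>\<infinity>\<^sup>3 / (q;q)\<^sub>\<infinity>\<close>, an instance of Kronecker's product formula for bilateral series
(\<open>bilateral_sum_eq_eta_quotient\<close>). Its proof decomposes a finite product, which telescopes to a power
of \<open>q\<close>, into partial fractions (\<open>finite_lambert_identity\<close>) and passes to the limit.

The first identity follows from the second, because the generating function of \<open>\<sigma>(3N+2)\<close> is
\<open>3 s\<^sup>2\<close>. Indeed, the product of two terms of \<open>s\<close> with index difference \<open>k \<noteq> 0\<close> splits by partial
fractions into two terms of the series \<open>\<Sum>n\<in>\<int>. q\<^bsup>2n\<^esup> / (1 - q\<^bsup>3n+1\<^esup>)\<close>, with factors depending on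
\<open>k\<close> only (\<open>lambert_term_product\<close>). That series is zero (\<open>lambert_term_2_has_sum_0\<close>): its two halves
cancel, by the symmetry that exchanges the factors in \<open>3N+2 = (3n+1)(3m+2)\<close>. Hence \<open>s\<^sup>2\<close> is the sum
of the squares of the terms of \<open>s\<close> (\<open>lambert_series_square\<close>), and this is the series of
\<open>(n+m+1) q\<^sup>N\<close> over the factorisations \<open>3N+2 = (3n+1)(3m+2)\<close>; the two factors add up to \<open>3(n+m+1)\<close>.

The third identity holds coefficient by coefficient, since the two factors in
\<open>3N+2 = (3n+1)(3m+2)\<close> have opposite Legendre symbols.\<close>

section \<open>Partial fractions for a finite product\<close>

text \<open>Lagrange interpolation for two monic polynomials of the same degree: their difference has
smaller degree, so it is determined by its values at the points \<open>a n\<close>.\<close>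

lemma prod_linear_partial_fractions:
  fixes a b :: "'i \<Rightarrow> 'a :: field"
  assumes K: "finite K" and inj: "inj_on a K" and w: "\<And>k. k \<in> K \<Longrightarrow> w \<noteq> a k"
  shows "(\<Prod>k\<in>K. (w - b k) / (w - a k)) =
           1 + (\<Sum>n\<in>K. (\<Prod>k\<in>K. a n - b k) / (\<Prod>k\<in>K-{n}. a n - a k) / (w - a n))"
proof -
  define r where "r n = (\<Prod>k\<in>K. a n - b k) / (\<Prod>k\<in>K-{n}. a n - a k)" for n
  define P where "P = (\<Prod>k\<in>K. [:- b k, 1:])"
  define Q0 where "Q0 = (\<Prod>k\<in>K. [:- a k, 1:])"
  define R where "R n = (\<Prod>k\<in>K-{n}. [:- a k, 1:])" for n
  define Q where "Q = Q0 + (\<Sum>n\<in>K. Polynomial.smult (r n) (R n))"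
  have degP: "Polynomial.degree P = card K" and degQ0: "Polynomial.degree Q0 = card K"
    unfolding P_def Q0_def by (subst degree_prod_eq_sum_degree; simp)+
  have degR: "Polynomial.degree (R n) < card K" if "n \<in> K" for n
  proof -
    have "Polynomial.degree (R n) = card (K - {n})"
      unfolding R_def by (subst degree_prod_eq_sum_degree) auto
    then show ?thesis using that K by (metis card_Diff1_less)
  qed
  have coeffR: "Polynomial.coeff (\<Sum>n\<in>K. Polynomial.smult (r n) (R n)) (card K) = 0"
    unfolding coeff_sum by (rule sum.neutral) (simp add: coeff_eq_0 degR)
  have "P = Q"
  proof (rule poly_eqI_degree_lead_coeff)
    have "Polynomial.coeff P (card K) = 1"
      using lead_coeff_prod[of "\<lambda>k. [:- b k, 1:]" K] degP by (simp add: P_def)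
    moreover have "Polynomial.coeff Q0 (card K) = 1"
      using lead_coeff_prod[of "\<lambda>k. [:- a k, 1:]" K] degQ0 by (simp add: Q0_def)
    ultimately show "Polynomial.coeff P (card K) = Polynomial.coeff Q (card K)"
      using coeffR by (simp add: Q_def)
    show "card K \<le> card (a ` K)" by (simp add: card_image inj)
    show "Polynomial.degree P \<le> card K" by (simp add: degP)
    have "Polynomial.degree (\<Sum>n\<in>K. Polynomial.smult (r n) (R n)) \<le> card K"
      by (rule degree_sum_le) (use K degR in \<open>auto intro: order.trans[OF degree_smult_le] less_imp_le\<close>)
    then show "Polynomial.degree Q \<le> card K"
      unfolding Q_def by (intro degree_add_le) (simp_all add: degQ0)
  next
    fix z assume "z \<in> a ` K"
    then obtain m where m: "m \<in> K" "z = a m" by auto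
    have "poly Q0 z = 0" using m K by (auto simp: Q0_def poly_prod)
    moreover have "(\<Sum>n\<in>K. r n * poly (R n) z) = r m * poly (R m) z"
    proof -
      have "(\<Sum>n\<in>K. r n * poly (R n) z) = (\<Sum>n\<in>{m}. r n * poly (R n) z)"
      proof (rule sum.mono_neutral_right)
        show "\<forall>i\<in>K - {m}. r i * poly (R i) z = 0"
        proof
          fix i assume i: "i \<in> K - {m}"
          have "poly (R i) z = 0" unfolding R_def poly_prod
            by (rule prod_zero) (use K m i in auto)
          then show "r i * poly (R i) z = 0" by simp
        qed
      qed (use K m in auto)
      then show ?thesis by simp
    qed
    moreover have "(\<Prod>k\<in>K-{m}. a m - a k) \<noteq> 0"
      using inj m K by (auto simp: inj_on_def)
    ultimately show "poly P z = poly Q z"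
      using m by (simp add: P_def Q_def poly_sum poly_prod R_def r_def)
  qed
  have nz: "(\<Prod>k\<in>K. w - a k) \<noteq> 0" using w K by auto
  have "(\<Prod>k\<in>K. (w - b k) / (w - a k)) = poly P w / (\<Prod>k\<in>K. w - a k)"
    by (simp add: P_def poly_prod prod_dividef)
  also have "poly P w = (\<Prod>k\<in>K. w - a k) + (\<Sum>n\<in>K. r n * (\<Prod>k\<in>K-{n}. w - a k))"
    by (simp add: \<open>P = Q\<close> Q_def Q0_def R_def poly_sum poly_prod)
  also have "(\<Sum>n\<in>K. r n * (\<Prod>k\<in>K-{n}. w - a k)) = (\<Sum>n\<in>K. r n / (w - a n)) * (\<Prod>k\<in>K. w - a k)"
    unfolding sum_distrib_right
  proof (rule sum.cong)
    fix n assume n: "n \<in> K"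
    show "r n * (\<Prod>k\<in>K-{n}. w - a k) = r n / (w - a n) * (\<Prod>k\<in>K. w - a k)"
      using w[OF n] by (simp add: prod.remove[OF K n])
  qed simp
  also have "((\<Prod>k\<in>K. w - a k) + (\<Sum>n\<in>K. r n / (w - a n)) * (\<Prod>k\<in>K. w - a k)) /
      (\<Prod>k\<in>K. w - a k) = 1 + (\<Sum>n\<in>K. r n / (w - a n))"
    using nz by (simp add: field_simps)
  finally show ?thesis by (simp add: r_def)
qed

text \<open>The finite product \<open>(q\<^sup>c; q\<^sup>3)\<^sub>M\<close>.\<close>

definition qprod :: "complex \<Rightarrow> nat \<Rightarrow> nat \<Rightarrow> complex" where
  "qprod q c M = (\<Prod>i<M. 1 - q ^ (3 * i + c))"

lemma power_ne_1:
  fixes q :: complex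
  assumes "norm q < 1" "n > 0"
  shows "q ^ n \<noteq> 1"
proof
  assume "q ^ n = 1"
  then have "norm q ^ n = 1" by (metis norm_one norm_power)
  moreover have "norm q ^ n < 1" using assms by (simp add: power_less_one_iff)
  ultimately show False by simp
qed

lemma power_inj_disc:
  fixes q :: complex
  assumes "norm q < 1" "q \<noteq> 0" "q ^ m = q ^ n"
  shows "m = n"
proof -
  have "norm q ^ m = norm q ^ n" using assms by (metis norm_power)
  then show ?thesis using assms by (metis power_inject_exp' zero_less_norm_iff less_irrefl)
qed

lemma qprod_nonzero: "norm q < 1 \<Longrightarrow> c > 0 \<Longrightarrow> qprod q c M \<noteq> 0"
  using power_ne_1[of q] by (auto simp: qprod_def)

text \<open>The finite sums and products below run over a window of \<open>2 * N\<close> indices. Counting away from its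
middle in both directions turns them into the nonnegative and the negative half of a bilateral
sum or product.\<close>

lemma prod_split_reflect:
  assumes "n \<le> (M::nat)"
  shows "(\<Prod>k<M. f k) = (\<Prod>i<n. f (n - 1 - i)) * (\<Prod>i<M-n. f (n + i))"
proof -
  have "(\<Prod>k<M. f k) = (\<Prod>k<n. f k) * (\<Prod>k\<in>{n..<M}. f k)"
    using assms by (metis atLeast0LessThan prod.atLeastLessThan_concat zero_le)
  also have "(\<Prod>k<n. f k) = (\<Prod>i<n. f (n - 1 - i))"
    by (subst prod.nat_diff_reindex[symmetric]) simp
  also have "(\<Prod>k\<in>{n..<M}. f k) = (\<Prod>i<M-n. f (n + i))"
    by (rule prod.reindex_bij_witness[of _ "\<lambda>i. n + i" "\<lambda>k. k - n"]) auto
  finally show ?thesis .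
qed

lemma sum_split_reflect:
  assumes "n \<le> (M::nat)"
  shows "(\<Sum>k<M. f k) = (\<Sum>i<n. f (n - 1 - i)) + (\<Sum>i<M-n. f (n + i))"
proof -
  have "(\<Sum>k<M. f k) = (\<Sum>k<n. f k) + (\<Sum>k\<in>{n..<M}. f k)"
    using assms by (metis atLeast0LessThan sum.atLeastLessThan_concat zero_le)
  also have "(\<Sum>k<n. f k) = (\<Sum>i<n. f (n - 1 - i))"
    by (subst sum.nat_diff_reindex[symmetric]) simp
  also have "(\<Sum>k\<in>{n..<M}. f k) = (\<Sum>i<M-n. f (n + i))"
    by (rule sum.reindex_bij_witness[of _ "\<lambda>i. n + i" "\<lambda>k. k - n"]) auto
  finally show ?thesis .
qed

text \<open>The exponents in the numerator and in the denominator differ from \<open>3 * N + 2\<close> by \<open>3 * i + 2\<close> and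
\<open>3 * i + 1\<close> on the lower half of the window, and by \<open>3 * i + 1\<close> and \<open>3 * i + 2\<close> on the upper half. So the
two halves cancel, up to one factor \<open>1 / q\<close> for each index of the lower half.\<close>

lemma finite_fraction_product:
  fixes q :: complex
  assumes q: "norm q < 1" "q \<noteq> 0"
  shows "(\<Prod>k<2*N. (q ^ (3*N+2) - q ^ (3*k+3)) / (q ^ (3*N+2) - q ^ (3*k+4))) = 1 / q ^ N"
proof -
  have *: "(q ^ (3*N+2) - q ^ (3*(N-1-i)+3)) / (q ^ (3*N+2) - q ^ (3*(N-1-i)+4))
     = (1 / q) * ((1 - q ^ (3*i+2)) / (1 - q ^ (3*i+1)))" if "i < N" for i
  proof -
    define k where "k = N - 1 - i"
    have N: "N = k + i + 1" using that by (simp add: k_def)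
    have "q ^ (3*N+2) - q ^ (3*k+3) = - (q ^ (3*k+3)) * (1 - q ^ (3*i+2))"
      by (simp add: N algebra_simps power_add power_numeral_reduce)
    moreover have "q ^ (3*N+2) - q ^ (3*k+4) = - (q ^ (3*k+3)) * (q * (1 - q ^ (3*i+1)))"
      by (simp add: N algebra_simps power_add power_numeral_reduce)
    ultimately show ?thesis unfolding k_def[symmetric] using q by simp
  qed
  have **: "(q ^ (3*N+2) - q ^ (3*(N+i)+3)) / (q ^ (3*N+2) - q ^ (3*(N+i)+4))
     = (1 - q ^ (3*i+1)) / (1 - q ^ (3*i+2))" for i
  proof -
    have "q ^ (3*N+2) - q ^ (3*(N+i)+3) = q ^ (3*N+2) * (1 - q ^ (3*i+1))"
      by (simp add: algebra_simps power_add power_numeral_reduce)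
    moreover have "q ^ (3*N+2) - q ^ (3*(N+i)+4) = q ^ (3*N+2) * (1 - q ^ (3*i+2))"
      by (simp add: algebra_simps power_add power_numeral_reduce)
    ultimately show ?thesis using q by simp
  qed
  have nz: "qprod q 1 N \<noteq> 0" "qprod q 2 N \<noteq> 0" using q qprod_nonzero by auto
  have split: "(\<Prod>k<2*N. f k) = (\<Prod>i<N. f (N - 1 - i)) * (\<Prod>i<N. f (N + i))" for f :: "nat \<Rightarrow> complex"
    using prod_split_reflect[of N "2*N" f] by simp
  have "(\<Prod>k<2*N. (q ^ (3*N+2) - q ^ (3*k+3)) / (q ^ (3*N+2) - q ^ (3*k+4)))
    = (\<Prod>i<N. (1/q) * ((1 - q ^ (3*i+2)) / (1 - q ^ (3*i+1)))) * (\<Prod>i<N. (1 - q ^ (3*i+1)) / (1 - q ^ (3*i+2)))"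
    unfolding split ** by (intro arg_cong2[where f="(*)"] prod.cong refl) (simp only: * lessThan_iff)
  also have "\<dots> = (1 / q) ^ N * (qprod q 2 N / qprod q 1 N) * (qprod q 1 N / qprod q 2 N)"
    by (simp only: prod.distrib prod_dividef qprod_def prod_constant card_lessThan power_divide)
  also have "\<dots> = 1 / q ^ N" using nz by (simp add: power_one_over)
  finally show ?thesis .
qed

text \<open>The residues in the partial fraction decomposition of the product in \<open>finite_fraction_product\<close>.
Below the index \<open>n\<close>, each factor of the numerator and of the denominator is normalised by pulling
out \<open>- (q ^ (3*k+3))\<close>, which cancels; above \<open>n\<close>, by pulling out \<open>q ^ (3*n+4)\<close>.
At \<open>n\<close> itself only the numerator has a factor.\<close>

lemma finite_residue:
  fixes q :: complex
  assumes q: "norm q < 1" "q \<noteq> 0" and n: "n < M"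
  shows "(\<Prod>k<M. q ^ (3*n+4) - q ^ (3*k+3)) / (\<Prod>k\<in>{..<M}-{n}. q ^ (3*n+4) - q ^ (3*k+4))
    = - (q ^ (2*n+3)) * (qprod q 1 (n+1) * qprod q 2 (M-1-n) / (qprod q 3 n * qprod q 3 (M-1-n)))"
proof -
  have num1: "(\<Prod>i<n. q ^ (3*n+4) - q ^ (3*(n-1-i)+3)) = (\<Prod>i<n. - (q ^ (3*(n-1-i)+3))) * (\<Prod>i<n. 1 - q ^ (3*i+4))"
    unfolding prod.distrib[symmetric]
  proof (rule prod.cong)
    fix i assume "i \<in> {..<n}"
    then obtain k where k: "n = k + i + 1" by (metis add.commute add.left_commute less_iff_Suc_add lessThan_iff Suc_eq_plus1 )
    show "q ^ (3*n+4) - q ^ (3*(n-1-i)+3) = - (q ^ (3*(n-1-i)+3)) * (1 - q ^ (3*i+4))"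
      by (simp add: k algebra_simps power_add power_numeral_reduce)
  qed simp
  have den1: "(\<Prod>i<n. q ^ (3*n+4) - q ^ (3*(n-1-i)+4)) = (\<Prod>i<n. - (q ^ (3*(n-1-i)+3))) * (q ^ n * (\<Prod>i<n. 1 - q ^ (3*i+3)))"
  proof -
    have "(\<Prod>i<n. q ^ (3*n+4) - q ^ (3*(n-1-i)+4)) = (\<Prod>i<n. - (q ^ (3*(n-1-i)+3)) * (q * (1 - q ^ (3*i+3))))"
    proof (rule prod.cong)
      fix i assume "i \<in> {..<n}"
      then obtain k where k: "n = k + i + 1" by (metis add.commute add.left_commute less_iff_Suc_add lessThan_iff Suc_eq_plus1 )
      show "q ^ (3*n+4) - q ^ (3*(n-1-i)+4) = - (q ^ (3*(n-1-i)+3)) * (q * (1 - q ^ (3*i+3)))"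
        by (simp add: k algebra_simps power_add power_numeral_reduce)
    qed simp
    then show ?thesis by (simp only: prod.distrib prod_constant card_lessThan)
  qed
  obtain J where J: "M = n + 1 + J" using less_imp_Suc_add[OF n] by auto
  have MnJ: "M - n = Suc J" by (simp add: J)
  have num2: "(\<Prod>i<M-n. q ^ (3*n+4) - q ^ (3*(n+i)+3)) =
     - (q ^ (3*n+3)) * (1 - q) * ((q ^ (3*n+4)) ^ J * qprod q 2 J)"
  proof -
    have "(\<Prod>i<M-n. q ^ (3*n+4) - q ^ (3*(n+i)+3)) =
       (q ^ (3*n+4) - q ^ (3*n+3)) * (\<Prod>i<J. q ^ (3*n+4) - q ^ (3*(n+Suc i)+3))"
      unfolding MnJ by (simp add: prod.lessThan_Suc_shift del: prod.lessThan_Suc)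
    also have "(\<Prod>i<J. q ^ (3*n+4) - q ^ (3*(n+Suc i)+3)) = (\<Prod>i<J. q ^ (3*n+4) * (1 - q ^ (3*i+2)))"
      by (intro prod.cong) (simp_all add: algebra_simps power_add power_numeral_reduce)
    also have "q ^ (3*n+4) - q ^ (3*n+3) = - (q ^ (3*n+3)) * (1 - q)"
      by (simp add: algebra_simps power_add power_numeral_reduce)
    finally show ?thesis by (simp only: prod.distrib qprod_def prod_constant card_lessThan)
  qed
  have den2: "(\<Prod>i<J. q ^ (3*n+4) - q ^ (3*(n+Suc i)+4)) = (q ^ (3*n+4)) ^ J * qprod q 3 J"
  proof -
    have "(\<Prod>i<J. q ^ (3*n+4) - q ^ (3*(n+Suc i)+4)) = (\<Prod>i<J. q ^ (3*n+4) * (1 - q ^ (3*i+3)))"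
      by (intro prod.cong) (simp_all add: algebra_simps power_add power_numeral_reduce)
    then show ?thesis by (simp add: prod.distrib qprod_def)
  qed
  have den: "(\<Prod>k\<in>{..<M}-{n}. q ^ (3*n+4) - q ^ (3*k+4)) =
     (\<Prod>i<n. q ^ (3*n+4) - q ^ (3*(n-1-i)+4)) * (\<Prod>i<J. q ^ (3*n+4) - q ^ (3*(n+Suc i)+4))"
  proof -
    have "{..<M}-{n} = {..<n} \<union> {Suc n..<M}" using n by auto
    moreover have "{..<n} \<inter> {Suc n..<M} = {}" by auto
    ultimately have "(\<Prod>k\<in>{..<M}-{n}. q ^ (3*n+4) - q ^ (3*k+4)) =
      (\<Prod>k<n. q ^ (3*n+4) - q ^ (3*k+4)) * (\<Prod>k\<in>{Suc n..<M}. q ^ (3*n+4) - q ^ (3*k+4))"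
      using prod.union_disjoint[of "{..<n}" "{Suc n..<M}" "\<lambda>k. q ^ (3*n+4) - q ^ (3*k+4)"]
      by (simp only: finite_lessThan finite_atLeastLessThan)
    also have "(\<Prod>k<n. q ^ (3*n+4) - q ^ (3*k+4)) = (\<Prod>i<n. q ^ (3*n+4) - q ^ (3*(n-1-i)+4))"
      by (subst prod.nat_diff_reindex[symmetric]) simp
    also have "(\<Prod>k\<in>{Suc n..<M}. q ^ (3*n+4) - q ^ (3*k+4)) = (\<Prod>i<J. q ^ (3*n+4) - q ^ (3*(n+Suc i)+4))"
      by (rule prod.reindex_bij_witness[of _ "\<lambda>i. n + Suc i" "\<lambda>k. k - Suc n"]) (auto simp: J)
    finally show ?thesis .
  qed
  have A: "qprod q 1 (n+1) = (1 - q) * (\<Prod>i<n. 1 - q ^ (3*i+4))"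
    unfolding qprod_def Suc_eq_plus1[symmetric] prod.lessThan_Suc_shift
    by (simp add: power_add power_numeral_reduce mult_ac)
  have nz1: "(\<Prod>i<n. - (q ^ (3*(n-1-i)+3))) \<noteq> 0" using q by simp
  have nz2: "(q ^ (3*n+4)) ^ J \<noteq> 0" "q ^ n \<noteq> 0" using q by auto
  have nz3: "qprod q 3 n \<noteq> 0" "qprod q 3 J \<noteq> 0" using q qprod_nonzero by auto
  have MJ: "M - 1 - n = J" by (simp add: J)
  have D: "(\<Prod>i<n. 1 - q ^ (3*i+3)) = qprod q 3 n" by (simp add: qprod_def)
  \<comment> \<open>The cancellation of the normalising factors, with a name for each product.\<close>
  have alg: "(x * a) * (- z * y * (g * b)) / (x * (u * c) * (g * d)) = - (z / u) * ((y * a * b) / (c * d))"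
    if "x \<noteq> 0" "g \<noteq> 0" "u \<noteq> 0" for x a z y g b u c d :: complex
    using that by (simp add: divide_simps) 
  have "(\<Prod>k<M. q ^ (3*n+4) - q ^ (3*k+3)) / (\<Prod>k\<in>{..<M}-{n}. q ^ (3*n+4) - q ^ (3*k+4))
    = - (q ^ (3*n+3) / q ^ n) * ((1 - q) * (\<Prod>i<n. 1 - q ^ (3*i+4)) * qprod q 2 J / (qprod q 3 n * qprod q 3 J))"
    unfolding den den1 den2 prod_split_reflect[OF less_imp_le[OF n]] num1 num2 D
    by (rule alg) (use nz1 nz2 in auto)
  also have "q ^ (3*n+3) / q ^ n = q ^ (2*n+3)"
  proof -
    have "q ^ (3*n+3) = q ^ (2*n+3) * q ^ n" by (simp flip: power_add)
    then show ?thesis using q by simp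
  qed
  finally show ?thesis unfolding A MJ .
qed

text \<open>Partial fractions applied to \<open>finite_fraction_product\<close> and multiplied by \<open>q ^ N\<close>. For fixed \<open>m\<close> and
\<open>N \<rightarrow> \<infinity>\<close>, all quotients of \<open>qprod\<close> tend to the same constant, and the right-hand side tends to \<open>1\<close>: this is
a finite form of the product formula for the bilateral Lambert series.\<close>

lemma finite_lambert_identity:
  fixes q :: complex
  assumes q: "norm q < 1" "q \<noteq> 0"
  shows "(\<Sum>m<N. qprod q 1 (N-m) * qprod q 2 (N+m) / (qprod q 3 (N-1-m) * qprod q 3 (N+m)) * (q ^ m / (1 - q ^ (3*m+1)))
     - qprod q 1 (N+m+1) * qprod q 2 (N-1-m) / (qprod q 3 (N+m) * qprod q 3 (N-1-m)) * (q ^ (2*m+1) / (1 - q ^ (3*m+2))))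
     = 1 - q ^ N"
proof -
  define \<rho> where "\<rho> n = qprod q 1 (n+1) * qprod q 2 (2*N-1-n) / (qprod q 3 n * qprod q 3 (2*N-1-n))" for n
  have ne: "q ^ (3*N+2) \<noteq> q ^ (3*k+4)" for k
  proof
    assume "q ^ (3*N+2) = q ^ (3*k+4)"
    then have "3*N+2 = 3*k+4" using power_inj_disc q by blast
    then show False by presburger
  qed
  \<comment> \<open>The poles are distinct because the powers of \<open>q\<close> are.\<close>
  have inj: "inj_on (\<lambda>k. q ^ (3*k+4)) {..<2*N}"
    using power_inj_disc[OF q] by (fastforce simp: inj_on_def)
  have "1 / q ^ N = 1 + (\<Sum>n<2*N. (\<Prod>k<2*N. q ^ (3*n+4) - q ^ (3*k+3)) / (\<Prod>k\<in>{..<2*N}-{n}. q ^ (3*n+4) - q ^ (3*k+4)) / (q ^ (3*N+2) - q ^ (3*n+4)))"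
    \<comment> \<open>The index \<open>N - 1 - m\<close> of the window is to become the index \<open>m\<close> of the bilateral series, and \<open>N + m\<close> the index \<open>- 1 - m\<close>.\<close>
    unfolding finite_fraction_product[OF q, symmetric]
    by (rule prod_linear_partial_fractions[OF _ inj]) (use ne in auto)
  also have "\<dots> = 1 + (\<Sum>n<2*N. - (q ^ (2*n+3)) * \<rho> n / (q ^ (3*N+2) - q ^ (3*n+4)))"
    by (intro arg_cong2[where f="(+)"] sum.cong refl) (simp only: finite_residue[OF q] \<rho>_def lessThan_iff)
  also have "(\<Sum>n<2*N. - (q ^ (2*n+3)) * \<rho> n / (q ^ (3*N+2) - q ^ (3*n+4))) =
     (\<Sum>m<N. - (q ^ (2*(N-1-m)+3)) * \<rho> (N-1-m) / (q ^ (3*N+2) - q ^ (3*(N-1-m)+4))) +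
     (\<Sum>m<N. - (q ^ (2*(N+m)+3)) * \<rho> (N+m) / (q ^ (3*N+2) - q ^ (3*(N+m)+4)))"
    by (subst sum_split_reflect[of N]) simp_all
  also have "(\<Sum>m<N. - (q ^ (2*(N-1-m)+3)) * \<rho> (N-1-m) / (q ^ (3*N+2) - q ^ (3*(N-1-m)+4)))
     = (\<Sum>m<N. \<rho> (N-1-m) * (q ^ m / (1 - q ^ (3*m+1))) / q ^ N)"
  proof (rule sum.cong)
    fix m assume "m \<in> {..<N}"
    then obtain n where n: "N = n + m + 1" by (metis add.commute add.left_commute less_iff_Suc_add lessThan_iff Suc_eq_plus1 )
    have d: "q ^ (3*N+2) - q ^ (3*n+4) = - (q ^ (3*n+4)) * (1 - q ^ (3*m+1))"
      by (simp add: n algebra_simps power_add power_numeral_reduce)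
    have "q ^ (2*n+3) * q ^ N = q ^ (3*n+4) * q ^ m"
      unfolding n power_add[symmetric] by (rule arg_cong[where f="power q"]) simp
    then have e: "q ^ (2*n+3) / q ^ (3*n+4) = q ^ m / q ^ N"
      by (intro frac_eq_eq[THEN iffD2]) (use q in \<open>simp_all only: mult.commute power_not_zero not_False_eq_True\<close>)
    have "- (q ^ (2*n+3)) * \<rho> n / (- (q ^ (3*n+4)) * (1 - q ^ (3*m+1))) = \<rho> n * (q ^ (2*n+3) / q ^ (3*n+4)) / (1 - q ^ (3*m+1))"
      by simp
    then show "- (q ^ (2*(N-1-m)+3)) * \<rho> (N-1-m) / (q ^ (3*N+2) - q ^ (3*(N-1-m)+4)) =
       \<rho> (N-1-m) * (q ^ m / (1 - q ^ (3*m+1))) / q ^ N"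
      unfolding e using d n by simp
  qed simp
  also have "(\<Sum>m<N. - (q ^ (2*(N+m)+3)) * \<rho> (N+m) / (q ^ (3*N+2) - q ^ (3*(N+m)+4)))
     = (\<Sum>m<N. - (\<rho> (N+m) * (q ^ (2*m+1) / (1 - q ^ (3*m+2))) / q ^ N))"
  proof (rule sum.cong)
    fix m 
    have d: "q ^ (3*N+2) - q ^ (3*(N+m)+4) = q ^ (3*N+2) * (1 - q ^ (3*m+2))"
      by (simp add: algebra_simps power_add power_numeral_reduce)
    have "q ^ (2*(N+m)+3) * q ^ N = q ^ (3*N+2) * q ^ (2*m+1)"
      unfolding power_add[symmetric] by (rule arg_cong[where f="power q"]) simp
    then have e: "q ^ (2*(N+m)+3) / q ^ (3*N+2) = q ^ (2*m+1) / q ^ N"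
      by (intro frac_eq_eq[THEN iffD2]) (use q in \<open>simp_all only: mult.commute power_not_zero not_False_eq_True\<close>)
    have "- (q ^ (2*(N+m)+3)) * \<rho> (N+m) / (q ^ (3*N+2) * (1 - q ^ (3*m+2))) = - (\<rho> (N+m) * (q ^ (2*(N+m)+3) / q ^ (3*N+2)) / (1 - q ^ (3*m+2)))"
      by simp
    then show "- (q ^ (2*(N+m)+3)) * \<rho> (N+m) / (q ^ (3*N+2) - q ^ (3*(N+m)+4)) =
       - (\<rho> (N+m) * (q ^ (2*m+1) / (1 - q ^ (3*m+2))) / q ^ N)"
      unfolding e d by simp
  qed simp
  finally have "1 / q ^ N = 1 + (\<Sum>m<N. \<rho> (N-1-m) * (q ^ m / (1 - q ^ (3*m+1))) - \<rho> (N+m) * (q ^ (2*m+1) / (1 - q ^ (3*m+2)))) / q ^ N"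
    by (simp only: sum_subtractf sum_negf sum_divide_distrib diff_divide_distrib add_uminus_conv_diff add.assoc)
  then have "1 - q ^ N = (\<Sum>m<N. \<rho> (N-1-m) * (q ^ m / (1 - q ^ (3*m+1))) - \<rho> (N+m) * (q ^ (2*m+1) / (1 - q ^ (3*m+2))))"
    using q by (simp add: field_simps)
  also have "\<dots> = (\<Sum>m<N. qprod q 1 (N-m) * qprod q 2 (N+m) / (qprod q 3 (N-1-m) * qprod q 3 (N+m)) * (q ^ m / (1 - q ^ (3*m+1)))
     - qprod q 1 (N+m+1) * qprod q 2 (N-1-m) / (qprod q 3 (N+m) * qprod q 3 (N-1-m)) * (q ^ (2*m+1) / (1 - q ^ (3*m+2))))"
  proof (rule sum.cong)
    fix m assume "m \<in> {..<N}"
    then obtain n where n: "N = n + m + 1" by (metis add.commute add.left_commute less_iff_Suc_add lessThan_iff Suc_eq_plus1 )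
    have "N - 1 - m + 1 = N - m" "2*N-1-(N-1-m) = N+m" "2*N-1-(N+m) = N-1-m" by (simp_all add: n)
    then show "\<rho> (N-1-m) * (q ^ m / (1 - q ^ (3*m+1))) - \<rho> (N+m) * (q ^ (2*m+1) / (1 - q ^ (3*m+2))) =
      qprod q 1 (N-m) * qprod q 2 (N+m) / (qprod q 3 (N-1-m) * qprod q 3 (N+m)) * (q ^ m / (1 - q ^ (3*m+1)))
     - qprod q 1 (N+m+1) * qprod q 2 (N-1-m) / (qprod q 3 (N+m) * qprod q 3 (N-1-m)) * (q ^ (2*m+1) / (1 - q ^ (3*m+2)))"
      unfolding \<rho>_def by simp
  qed simp
  finally show ?thesis by simp
qed

section \<open>The product formula for the bilateral Lambert series\<close>

lemma qprod_tendsto: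
  assumes q: "norm q < 1" and c: "c > 0"
  shows "\<exists>L. L \<noteq> 0 \<and> qprod q c \<longlonglongrightarrow> L"
proof -
  have "summable (\<lambda>i. norm (q ^ c) * (norm (q ^ 3)) ^ i)"
    using q by (intro summable_mult summable_geometric) (simp add: norm_power power_less_one_iff)
  moreover have "norm (- (q ^ (3*i+c))) = norm (q ^ c) * norm (q ^ 3) ^ i" for i
    by (simp add: norm_mult norm_power power_add flip: power_mult)
  ultimately have "summable (\<lambda>i. norm (- (q ^ (3*i+c))))" by simp
  then have "convergent_prod (\<lambda>i. 1 - q ^ (3*i+c))"
    by (intro abs_convergent_prod_imp_convergent_prod summable_imp_abs_convergent_prod) simp
  then obtain L where L: "(\<lambda>i. 1 - q ^ (3*i+c)) has_prod L" by blast
  have "L \<noteq> 0"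
  proof
    assume "L = 0"
    then obtain i where "1 - q ^ (3*i+c) = 0" using L by (auto simp: has_prod_def)
    then show False using power_ne_1[of q "3*i+c"] q c by simp
  qed
  moreover have "qprod q c \<longlonglongrightarrow> L"
    using has_prod_imp_tendsto'[OF L] by (simp add: qprod_def[abs_def])
  ultimately show ?thesis by blast
qed

lemma qprod_mult_residues:
  "qprod q 1 M * qprod q 2 M * qprod q 3 M = (\<Prod>i<3*M. 1 - q ^ Suc i)"
proof (induction M)
  case (Suc M)
  have step: "qprod q c (Suc M) = qprod q c M * (1 - q ^ (3 * M + c))" for c
    by (simp add: qprod_def)
  have "3 * Suc M = Suc (Suc (Suc (3*M)))" by simp
  then have "(\<Prod>i<3 * Suc M. 1 - q ^ Suc i) = (\<Prod>i<3*M. 1 - q ^ Suc i) *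
      ((1 - q ^ Suc (3*M)) * (1 - q ^ Suc (Suc (3*M))) * (1 - q ^ Suc (Suc (Suc (3*M)))))"
    by (simp only: prod.lessThan_Suc mult.assoc)
  also have "\<dots> = (qprod q 1 M * (1 - q ^ (3*M+1))) * (qprod q 2 M * (1 - q ^ (3*M+2))) *
      (qprod q 3 M * (1 - q ^ (3*M+3)))"
    unfolding Suc.IH[symmetric] by (simp add: power_add power3_eq_cube mult_ac)
  finally show ?case unfolding step by (rule sym)
qed (simp add: qprod_def)

text \<open>Let \<open>\<alpha>\<close>, \<open>\<beta>\<close>, \<open>\<delta>\<close> be the limits of \<open>qprod q 1\<close>, \<open>qprod q 2\<close>, \<open>qprod q 3\<close>. By dominated convergence for series,
\<open>finite_lambert_identity\<close> gives \<open>\<alpha> * \<beta> / \<delta>\<^sup>2 * s = 1\<close> for the sum \<open>s\<close> of the series. Since \<open>\<delta>\<close> is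
\<open>(q\<^sup>3; q\<^sup>3)\<^sub>\<infinity>\<close> and \<open>\<alpha> * \<beta> * \<delta>\<close> is \<open>(q; q)\<^sub>\<infinity>\<close>, this is the claim.\<close>

lemma bilateral_sum_eq_eta_quotient:
  fixes q :: complex
  assumes q: "norm q < 1" "q \<noteq> 0"
  shows "(\<lambda>m. q ^ m / (1 - q ^ (3*m+1)) - q ^ (2*m+1) / (1 - q ^ (3*m+2))) sums
           (qq_inf (q ^ 3) ^ 3 / qq_inf q)"
proof -
  obtain \<alpha> where \<alpha>: "\<alpha> \<noteq> 0" "qprod q 1 \<longlonglongrightarrow> \<alpha>" using qprod_tendsto[of q 1] q by auto
  obtain \<beta> where \<beta>: "\<beta> \<noteq> 0" "qprod q 2 \<longlonglongrightarrow> \<beta>" using qprod_tendsto[of q 2] q by auto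
  obtain \<delta> where \<delta>: "\<delta> \<noteq> 0" "qprod q 3 \<longlonglongrightarrow> \<delta>" using qprod_tendsto[of q 3] q by auto
  have q3: "norm (q ^ 3) < 1" using q by (simp add: norm_power power_less_one_iff)
  have "qprod q 3 = (\<lambda>M. \<Prod>i<M. 1 - (q ^ 3) ^ Suc i)"
    by (auto simp: qprod_def fun_eq_iff power_add simp flip: power_mult intro!: prod.cong)
  then have "qprod q 3 \<longlonglongrightarrow> qq_inf (q ^ 3)"
    using has_prod_imp_tendsto'[OF has_prod_qq_inf[OF q3]] by simp
  then have \<delta>_eq: "\<delta> = qq_inf (q ^ 3)" using \<delta> LIMSEQ_unique by blast
  have "(\<lambda>M. \<Prod>i<3*M. 1 - q ^ Suc i) \<longlonglongrightarrow> qq_inf q"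
    using LIMSEQ_subseq_LIMSEQ[OF has_prod_imp_tendsto'[OF has_prod_qq_inf[OF q(1)]], of "\<lambda>M. 3*M"]
    by (simp add: strict_mono_def o_def)
  moreover have "(\<lambda>M. \<Prod>i<3*M. 1 - q ^ Suc i) \<longlonglongrightarrow> \<alpha> * \<beta> * \<delta>"
    unfolding qprod_mult_residues[symmetric] by (intro tendsto_intros \<alpha> \<beta> \<delta>)
  ultimately have prod_eq: "qq_inf q = \<alpha> * \<beta> * \<delta>" using LIMSEQ_unique by blast
  obtain A where A: "\<And>n. norm (qprod q 1 n) \<le> A"
    using convergent_imp_Bseq[OF convergentI[OF \<alpha>(2)]] by (auto simp: Bseq_def)
  obtain B where B: "\<And>n. norm (qprod q 2 n) \<le> B"
    using convergent_imp_Bseq[OF convergentI[OF \<beta>(2)]] by (auto simp: Bseq_def)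
  have "(\<lambda>n. inverse (qprod q 3 n)) \<longlonglongrightarrow> inverse \<delta>" by (intro tendsto_intros \<delta>)
  then obtain D where D: "\<And>n. norm (inverse (qprod q 3 n)) \<le> D"
    using convergent_imp_Bseq[OF convergentI] by (fastforce simp: Bseq_def)
  have A0: "A \<ge> 0" and B0: "B \<ge> 0" and D0: "D \<ge> 0"
    using order.trans[OF norm_ge_zero A] order.trans[OF norm_ge_zero B]
      order.trans[OF norm_ge_zero D] by auto
  define C where "C = A * B * (D * D)"
  have C: "norm (qprod q 1 i * qprod q 2 j / (qprod q 3 k * qprod q 3 l)) \<le> C" for i j k l
  proof -
    have "qprod q 1 i * qprod q 2 j / (qprod q 3 k * qprod q 3 l) =
      qprod q 1 i * qprod q 2 j * (inverse (qprod q 3 k) * inverse (qprod q 3 l))"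
      by (simp add: divide_inverse)
    then show ?thesis unfolding C_def
      by (simp only: norm_mult) (intro mult_mono A B D mult_nonneg_nonneg norm_ge_zero A0 B0 D0)
  qed
  have C0: "C \<ge> 0" by (simp add: C_def A0 B0 D0)
  define s where "s m = q ^ m / (1 - q ^ (3*m+1))" for m
  define s' where "s' m = q ^ (2*m+1) / (1 - q ^ (3*m+2))" for m
  \<comment> \<open>The summands of the finite identity, continued by zero so that the range of \<open>m\<close> does not depend on \<open>N\<close>.\<close>
  define f where "f m N = (if m < N then
      qprod q 1 (N-m) * qprod q 2 (N+m) / (qprod q 3 (N-1-m) * qprod q 3 (N+m)) * s m
      - qprod q 1 (N+m+1) * qprod q 2 (N-1-m) / (qprod q 3 (N+m) * qprod q 3 (N-1-m)) * s' m
      else 0)" for m N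
  have den: "1 - norm q \<le> norm (1 - q ^ n)" if "n > 0" for n
  proof -
    have "norm (q ^ n) \<le> norm q ^ 1" unfolding norm_power using q that by (intro power_decreasing) auto
    moreover have "1 - norm (q ^ n) \<le> norm (1 - q ^ n)" using norm_triangle_ineq2[of 1 "q ^ n"] by simp
    ultimately show ?thesis by simp
  qed
  have s: "norm (s m) \<le> norm q ^ m / (1 - norm q)" for m
    unfolding s_def norm_divide norm_power[symmetric]
    using den[of "3*m+1"] q by (intro frac_le) auto
  have s': "norm (s' m) \<le> norm q ^ m / (1 - norm q)" for m
  proof -
    have "norm (q ^ (2*m+1)) \<le> norm q ^ m"
      unfolding norm_power using q by (intro power_decreasing) auto
    then show ?thesis
      unfolding s'_def norm_divide using den[of "3*m+2"] q by (intro frac_le) auto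
  qed
  define M where "M m = 2 * C / (1 - norm q) * norm q ^ m" for m
  have fM: "norm (f m N) \<le> M m" for m N
  proof (cases "m < N")
    case True
    have "norm (f m N) \<le> C * (norm q ^ m / (1 - norm q)) + C * (norm q ^ m / (1 - norm q))"
      unfolding f_def using True
      by (simp only: if_True) (rule order.trans[OF norm_triangle_ineq4], unfold norm_mult[of "_ / _"],
          intro add_mono mult_mono C s s' C0 norm_ge_zero)
    then show ?thesis by (simp add: M_def)
  next
    case False
    then show ?thesis using C0 q by (simp add: f_def M_def)
  qed
  have M: "summable M" unfolding M_def using q by (intro summable_mult summable_geometric) auto
  define K where "K = \<alpha> * \<beta> / (\<delta> * \<delta>)"
  have lim: "(\<lambda>N. f m N) \<longlonglongrightarrow> K * (s m - s' m)" for m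
  proof -
    have sh: "filterlim (\<lambda>N. N - a) at_top sequentially" for a :: nat
      by (rule filterlim_minus_const_nat_at_top)
    have sh': "filterlim (\<lambda>N. N + a) at_top sequentially" for a :: nat
      by (rule filterlim_add_const_nat_at_top)
    have "(\<lambda>N. qprod q 1 (N-m) * qprod q 2 (N+m) / (qprod q 3 (N-(1+m)) * qprod q 3 (N+m)) * s m
      - qprod q 1 (N+(m+1)) * qprod q 2 (N-(1+m)) / (qprod q 3 (N+m) * qprod q 3 (N-(1+m))) * s' m)
      \<longlonglongrightarrow> \<alpha> * \<beta> / (\<delta> * \<delta>) * s m - \<alpha> * \<beta> / (\<delta> * \<delta>) * s' m"
      by (intro tendsto_intros filterlim_compose[OF \<alpha>(2)] filterlim_compose[OF \<beta>(2)]
          filterlim_compose[OF \<delta>(2)] sh sh') (use \<delta> in auto)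
    moreover have "eventually (\<lambda>N. qprod q 1 (N-m) * qprod q 2 (N+m) / (qprod q 3 (N-(1+m)) * qprod q 3 (N+m)) * s m
      - qprod q 1 (N+(m+1)) * qprod q 2 (N-(1+m)) / (qprod q 3 (N+m) * qprod q 3 (N-(1+m))) * s' m = f m N) sequentially"
      using eventually_gt_at_top[of m] by eventually_elim (simp add: f_def add.assoc)
    ultimately have "f m \<longlonglongrightarrow> \<alpha> * \<beta> / (\<delta> * \<delta>) * s m - \<alpha> * \<beta> / (\<delta> * \<delta>) * s' m"
      by (rule Lim_transform_eventually)
    then show ?thesis by (simp only: K_def right_diff_distrib)
  qed
  have suminf_f: "suminf (\<lambda>m. f m N) = 1 - q ^ N" for N
  proof -
    have "suminf (\<lambda>m. f m N) = (\<Sum>m<N. f m N)" by (rule suminf_finite) (auto simp: f_def)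
    also have "\<dots> = 1 - q ^ N"
      by (rule trans[OF sum.cong finite_lambert_identity[OF q]])
        (simp_all only: f_def s_def s'_def lessThan_iff if_True)
    finally show ?thesis .
  qed
  have "summable (\<lambda>m. norm (K * (s m - s' m))) \<and>
      (\<lambda>N. suminf (\<lambda>m. f m N)) \<longlonglongrightarrow> suminf (\<lambda>m. K * (s m - s' m))"
    using tannerys_theorem[of f "\<lambda>m. K * (s m - s' m)" sequentially M] lim M fM by (simp add: case_prod_unfold)
  then have sm: "summable (\<lambda>m. K * (s m - s' m))"
    and l: "(\<lambda>N. 1 - q ^ N) \<longlonglongrightarrow> suminf (\<lambda>m. K * (s m - s' m))"
    using summable_norm_cancel[of "\<lambda>m. K * (s m - s' m)"] unfolding suminf_f by blast+
  have "(\<lambda>N. 1 - q ^ N) \<longlonglongrightarrow> 1 - 0" using q by (intro tendsto_intros LIMSEQ_power_zero) auto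
  with l have "suminf (\<lambda>m. K * (s m - s' m)) = 1" using LIMSEQ_unique by fastforce
  with sm have "(\<lambda>m. K * (s m - s' m)) sums 1" by (simp add: sums_iff)
  then have "(\<lambda>m. inverse K * (K * (s m - s' m))) sums (inverse K * 1)" by (rule sums_mult)
  moreover have "K \<noteq> 0" using \<alpha> \<beta> \<delta> by (simp add: K_def)
  ultimately have "(\<lambda>m. s m - s' m) sums inverse K" by (simp add: mult.assoc[symmetric])
  moreover have "inverse K = qq_inf (q ^ 3) ^ 3 / qq_inf q"
    unfolding K_def prod_eq \<delta>_eq[symmetric] using \<alpha> \<beta> \<delta> by (simp add: power3_eq_cube)
  ultimately show ?thesis by (simp only: s_def s'_def)
qed

section \<open>Unconditional sums\<close>

lemma has_sum_int_halves:
  fixes f :: "int \<Rightarrow> complex"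
  assumes "((\<lambda>n::nat. f (int n)) has_sum a) UNIV" and "((\<lambda>n::nat. f (- 1 - int n)) has_sum b) UNIV"
  shows "(f has_sum (a + b)) UNIV"
proof -
  have "(f has_sum a) {0..}"
    using assms(1) by (subst (asm) has_sum_reindex_bij_betw[of int UNIV "{0..}" f a])
      (intro bij_betwI[of _ _ _ nat], auto)
  moreover have "(f has_sum b) {..<0}"
    using assms(2) by (subst (asm) has_sum_reindex_bij_betw[of "\<lambda>n. - 1 - int n" UNIV "{..<0}" f b])
      (auto intro!: bij_betwI[of _ _ _ "\<lambda>i. nat (- 1 - i)"])
  ultimately have "(f has_sum (a + b)) ({0..} \<union> {..<0})" by (rule has_sum_Un_disjoint) auto
  also have "{0..} \<union> {..<0::int} = UNIV" by auto
  finally show ?thesis .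
qed

lemma has_sum_product_complex:
  fixes f :: "'a \<Rightarrow> complex" and g :: "'b \<Rightarrow> complex"
  assumes f: "(f has_sum a) A" and g: "(g has_sum b) B"
  shows "((\<lambda>(x,y). f x * g y) has_sum (a * b)) (A \<times> B)"
proof (rule has_sum_SigmaI)
  show "((\<lambda>y. (case (x, y) of (x, y) \<Rightarrow> f x * g y)) has_sum (f x * b)) B" for x
    using has_sum_cmult_right[OF g] by simp
  show "((\<lambda>x. f x * b) has_sum (a * b)) A" by (rule has_sum_cmult_left[OF f])
  have fn: "(\<lambda>x. norm (f x)) summable_on A" and gn: "(\<lambda>x. norm (g x)) summable_on B"
    using f g summable_on_iff_abs_summable_on_complex by (auto simp: summable_on_def)
  have "(\<lambda>z. norm (f (fst z)) * norm (g (snd z))) summable_on (A \<times> B)"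
  proof (rule summable_on_SigmaI)
    show "((\<lambda>y. norm (f (fst (x, y))) * norm (g (snd (x, y)))) has_sum
       (norm (f x) * infsum (\<lambda>y. norm (g y)) B)) B" for x
      using has_sum_cmult_right[OF has_sum_infsum[OF gn]] by simp
    show "(\<lambda>x. norm (f x) * infsum (\<lambda>y. norm (g y)) B) summable_on A"
      by (rule summable_on_cmult_left[OF fn])
  qed auto
  then have "(\<lambda>z. norm (case z of (x,y) \<Rightarrow> f x * g y)) summable_on (A \<times> B)"
    by (simp add: case_prod_unfold norm_mult)
  then show "(\<lambda>(x,y). f x * g y) summable_on (A \<times> B)" by (rule abs_summable_summable)
qed

text \<open>Collecting the terms of an unconditionally convergent family by the exponent of \<open>q\<close>.\<close>

lemma sums_by_exponent:
  fixes q :: complex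
  assumes f: "((\<lambda>x. f x * q ^ h x) has_sum s) UNIV" and fin: "\<And>N. finite {x. h x = N}"
  shows "(\<lambda>N. (\<Sum>x | h x = N. f x) * q ^ N) sums s"
proof (rule has_sum_imp_sums)
  have "bij_betw (\<lambda>x. (h x, x)) UNIV (SIGMA N:UNIV. {x. h x = N})"
    by (rule bij_betwI[of _ _ _ snd]) auto
  then have "((\<lambda>z. f (snd z) * q ^ h (snd z)) has_sum s) (SIGMA N:UNIV. {x. h x = N})"
    using has_sum_reindex_bij_betw[of "\<lambda>x. (h x, x)" UNIV _ "\<lambda>z. f (snd z) * q ^ h (snd z)" s] f by simp
  then show "((\<lambda>N. (\<Sum>x | h x = N. f x) * q ^ N) has_sum s) UNIV"
  proof (rule has_sum_SigmaD)
    show "((\<lambda>x. f (snd (N, x)) * q ^ h (snd (N, x))) has_sum (\<Sum>x | h x = N. f x) * q ^ N) {x. h x = N}" for N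
      using has_sum_finite[OF fin, of "\<lambda>x. f x * q ^ h x" N] by (simp add: sum_distrib_right)
  qed
qed

lemma has_sum_geometric:
  fixes c :: complex
  assumes "norm c < 1"
  shows "((\<lambda>m. c ^ m) has_sum (1 / (1 - c))) UNIV"
  using assms by (intro norm_summable_imp_has_sum geometric_sums) (simp_all add: norm_power summable_geometric)

lemma has_sum_Suc_geometric:
  fixes c :: complex
  assumes "norm c < 1"
  shows "((\<lambda>m. of_nat (Suc m) * c ^ m) has_sum (1 / (1 - c)\<^sup>2)) UNIV"
proof (rule norm_summable_imp_has_sum)
  have "summable (\<lambda>m. of_nat (Suc m) * norm c ^ m)"
    using geometric_deriv_sums[of "norm c"] assms by (auto simp: sums_iff)
  then show "summable (\<lambda>m. norm (of_nat (Suc m) * c ^ m))"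
    by (simp only: norm_mult norm_power norm_of_nat)
qed (rule geometric_deriv_sums[OF assms])

lemma has_sum_index_geometric:
  fixes c :: complex
  assumes "norm c < 1"
  shows "((\<lambda>m. of_nat m * c ^ m) has_sum (c / (1 - c)\<^sup>2)) UNIV"
proof -
  have "c \<noteq> 1" using assms by auto
  then have "1 / (1 - c)\<^sup>2 - 1 / (1 - c) = c / (1 - c)\<^sup>2"
    by (simp add: power2_eq_square divide_simps)
  moreover have "((\<lambda>m. of_nat (Suc m) * c ^ m + - (c ^ m)) has_sum (1 / (1 - c)\<^sup>2 + - (1 / (1 - c)))) UNIV"
    by (intro has_sum_add has_sum_Suc_geometric has_sum_geometric assms) (simp add: has_sum_uminus has_sum_geometric assms)
  ultimately show ?thesis by (simp add: algebra_simps)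
qed

text \<open>The bounds are chosen to cover all double series below at once: the family is dominated by the
product of two copies of the series of \<open>Suc n * \<bar>q\<bar> ^ n\<close>.\<close>

lemma double_sum_summable:
  fixes q :: complex and w :: "nat \<Rightarrow> nat \<Rightarrow> complex"
  assumes q: "norm q < 1" and h: "\<And>n m. n + m \<le> h n m"
    and w: "\<And>n m. norm (w n m) \<le> real (Suc n) * real (Suc m)"
  shows "(\<lambda>(n,m). w n m * q ^ h n m) summable_on UNIV"
proof -
  have "((\<lambda>(n,m). (of_nat (Suc n) * q ^ n) * (of_nat (Suc m) * q ^ m)) has_sum
      (1 / (1 - q)\<^sup>2 * (1 / (1 - q)\<^sup>2))) (UNIV \<times> UNIV)"
    by (intro has_sum_product_complex has_sum_Suc_geometric q)
  then have "(\<lambda>(n,m). (of_nat (Suc n) * q ^ n) * (of_nat (Suc m) * q ^ m)) summable_on (UNIV \<times> UNIV)"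
    unfolding summable_on_def by blast
  then have "(\<lambda>z. norm (case z of (n,m) \<Rightarrow> (of_nat (Suc n) * q ^ n) * (of_nat (Suc m) * q ^ m))) summable_on (UNIV \<times> UNIV)"
    using summable_on_iff_abs_summable_on_complex by blast
  then have "(\<lambda>z. norm (case z of (n,m) \<Rightarrow> w n m * q ^ h n m)) summable_on (UNIV \<times> UNIV)"
  proof (rule Infinite_Sum.abs_summable_on_comparison_test)
    fix z :: "nat \<times> nat"
    obtain n m where z: "z = (n,m)" by force
    have "norm (w n m * q ^ h n m) \<le> (real (Suc n) * real (Suc m)) * norm q ^ (n + m)"
      unfolding norm_mult norm_power using q h by (intro mult_mono w power_decreasing) auto
    then show "norm (case z of (n,m) \<Rightarrow> w n m * q ^ h n m) \<le>
      norm (case z of (n,m) \<Rightarrow> (of_nat (Suc n) * q ^ n) * (of_nat (Suc m) * q ^ m))"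
      unfolding z prod.case norm_mult norm_power norm_of_nat by (simp add: power_add mult_ac)
  qed
  then show ?thesis using abs_summable_summable by fastforce
qed

lemma finite_exponent_fibre:
  assumes "\<And>n m. n + m \<le> (h n m :: nat)"
  shows "finite {(n,m). h n m = N}"
proof (rule finite_subset)
  have "n \<le> h n m" "m \<le> h n m" for n m using assms[of n m] by auto
  then show "{(n,m). h n m = N} \<subseteq> {..N} \<times> {..N}" by auto
qed auto

section \<open>Divisors of numbers prime to three\<close>

text \<open>In a factorisation of \<open>3 * N + 2\<close>, one factor is \<open>1\<close> and the other is \<open>2\<close> modulo \<open>3\<close>. So the pairs
\<open>(n, m)\<close> with \<open>(3 * n + 1) * (3 * m + 2) = 3 * N + 2\<close> list every divisor exactly once, as a first or
as a second factor.\<close>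

lemma divisor_sum_3n2:
  fixes g :: "nat \<Rightarrow> 'a :: comm_monoid_add"
  shows "(\<Sum>d | d dvd 3*N+2. g d) = (\<Sum>(n,m) | 3*n*m+2*n+m = N. g (3*n+1) + g (3*m+2))"
proof -
  define F where "F = {(n,m). 3*n*m+2*n+m = N}"
  have fin: "finite F" unfolding F_def by (rule finite_exponent_fibre) simp
  have F_iff: "(n,m) \<in> F \<longleftrightarrow> (3*n+1) * (3*m+2) = 3*N+2" for n m
  proof -
    have "(3*n+1) * (3*m+2) = 3 * (3*n*m+2*n+m) + 2" by (simp add: algebra_simps)
    moreover have "3 * x + 2 = 3 * N + 2 \<longleftrightarrow> x = N" for x by presburger
    ultimately show ?thesis by (simp only: F_def mem_Collect_eq prod.case)
  qed
  have eq: "{d. d dvd 3*N+2} = (\<lambda>(n,m). 3*n+1) ` F \<union> (\<lambda>(n,m). 3*m+2) ` F" (is "?D = ?L \<union> ?R")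
  proof
    show "?D \<subseteq> ?L \<union> ?R"
    proof
      fix d assume "d \<in> ?D"
      then obtain e where e: "3*N+2 = d * e" by (auto simp: dvd_def)
      have "(d mod 3) * (e mod 3) mod 3 = (3*N+2) mod 3" by (metis e mod_mult_eq)
      then have *: "(d mod 3) * (e mod 3) mod 3 = 2" by presburger
      have "d mod 3 \<in> {0, 1, 2}" "e mod 3 \<in> {0, 1, 2}" by auto
      then have "d mod 3 = 1 \<and> e mod 3 = 2 \<or> d mod 3 = 2 \<and> e mod 3 = 1"
        using * by auto
      then show "d \<in> ?L \<union> ?R"
      proof
        assume "d mod 3 = 1 \<and> e mod 3 = 2"
        then have "d = 3*(d div 3)+1" "e = 3*(e div 3)+2" by presburger+
        then have "(d div 3, e div 3) \<in> F" unfolding F_iff using e by metis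
        then show ?thesis using \<open>d = _\<close> by (auto intro!: image_eqI[of _ _ "(d div 3, e div 3)"])
      next
        assume "d mod 3 = 2 \<and> e mod 3 = 1"
        then have "d = 3*(d div 3)+2" "e = 3*(e div 3)+1" by presburger+
        then have "(e div 3, d div 3) \<in> F" unfolding F_iff using e by (metis mult.commute)
        then show ?thesis using \<open>d = _\<close> by (auto intro!: image_eqI[of _ _ "(e div 3, d div 3)"])
      qed
    qed
    show "?L \<union> ?R \<subseteq> ?D" 
    proof safe
      fix n m assume "(n, m) \<in> F"
      then have "3*N+2 = (3*n+1) * (3*m+2)" unfolding F_iff by simp
      then show "3*n+1 dvd 3*N+2" "3*m+2 dvd 3*N+2" by (metis dvd_triv_left dvd_triv_right)+
    qed
  qed
  have inj1: "inj_on (\<lambda>(n,m). 3*n+1) F"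
  proof (rule inj_onI, clarify)
    fix n m n' m' assume *: "(n, m) \<in> F" "(n', m') \<in> F" "3*n+1 = 3*n'+1"
    then have "n' = n" by simp
    with * have "(3*n+1) * (3*m+2) = (3*n'+1) * (3*m'+2)" unfolding F_iff by simp
    with \<open>n' = n\<close> have "(3*n+1) * (3*m+2) = (3*n+1) * (3*m'+2)" by (simp only:)
    then have "3*m+2 = 3*m'+2" by (subst (asm) mult_left_cancel) simp_all
    with \<open>n' = n\<close> show "n = n' \<and> m = m'" by simp
  qed
  have inj2: "inj_on (\<lambda>(n,m). 3*m+2) F"
  proof (rule inj_onI, clarify)
    fix n m n' m' assume *: "(n, m) \<in> F" "(n', m') \<in> F" "3*m+2 = 3*m'+2"
    then have "m' = m" by simp
    with * have "(3*n+1) * (3*m+2) = (3*n'+1) * (3*m'+2)" unfolding F_iff by simp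
    with \<open>m' = m\<close> have "(3*n+1) * (3*m+2) = (3*n'+1) * (3*m+2)" by (simp only:)
    then have "3*n+1 = 3*n'+1" by (subst (asm) mult_right_cancel) simp_all
    with \<open>m' = m\<close> show "n = n' \<and> m = m'" by simp
  qed
  have disj: "?L \<inter> ?R = {}" by (auto; presburger)
  have "(\<Sum>d | d dvd 3*N+2. g d) = sum g ?L + sum g ?R"
    unfolding eq by (rule sum.union_disjoint) (use fin disj in auto)
  also have "\<dots> = (\<Sum>z\<in>F. g (3 * fst z + 1)) + (\<Sum>z\<in>F. g (3 * snd z + 2))"
    using sum.reindex[OF inj1, of g] sum.reindex[OF inj2, of g] by (simp add: case_prod_unfold o_def)
  finally show ?thesis by (simp add: F_def sum.distrib case_prod_unfold)
qed

text \<open>In a factorisation of \<open>3 * N + 1\<close>, both factors are \<open>1\<close> or both are \<open>2\<close> modulo \<open>3\<close>; here the first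
factors alone already list every divisor once.\<close>

lemma divisor_sum_3n1:
  fixes g :: "nat \<Rightarrow> 'a :: comm_monoid_add"
  shows "(\<Sum>d | d dvd 3*N+1. g d) =
    (\<Sum>(n,m) | 3*n*m+n+m = N. g (3*n+1)) + (\<Sum>(n,m) | 3*n*m+2*n+2*m+1 = N. g (3*n+2))"
proof -
  define F where "F = {(n,m). 3*n*m+n+m = N}"
  define G where "G = {(n,m). 3*n*m+2*n+2*m+1 = N}"
  have finF: "finite F" unfolding F_def by (rule finite_exponent_fibre) simp
  have finG: "finite G" unfolding G_def by (rule finite_exponent_fibre) simp
  have F_iff: "(n,m) \<in> F \<longleftrightarrow> (3*n+1) * (3*m+1) = 3*N+1" for n m
  proof -
    have "(3*n+1) * (3*m+1) = 3 * (3*n*m+n+m) + 1" by (simp add: algebra_simps)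
    moreover have "3 * x + 1 = 3 * N + 1 \<longleftrightarrow> x = N" for x by presburger
    ultimately show ?thesis by (simp only: F_def mem_Collect_eq prod.case)
  qed
  have G_iff: "(n,m) \<in> G \<longleftrightarrow> (3*n+2) * (3*m+2) = 3*N+1" for n m
  proof -
    have "(3*n+2) * (3*m+2) = 3 * (3*n*m+2*n+2*m+1) + 1" by (simp add: algebra_simps)
    moreover have "3 * x + 1 = 3 * N + 1 \<longleftrightarrow> x = N" for x by presburger
    ultimately show ?thesis by (simp only: G_def mem_Collect_eq prod.case)
  qed
  have eq: "{d. d dvd 3*N+1} = (\<lambda>(n,m). 3*n+1) ` F \<union> (\<lambda>(n,m). 3*n+2) ` G" (is "?D = ?L \<union> ?R")
  proof
    show "?D \<subseteq> ?L \<union> ?R"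
    proof
      fix d assume "d \<in> ?D"
      then obtain e where e: "3*N+1 = d * e" by (auto simp: dvd_def)
      have "(d mod 3) * (e mod 3) mod 3 = (3*N+1) mod 3" by (metis e mod_mult_eq)
      then have *: "(d mod 3) * (e mod 3) mod 3 = 1" by presburger
      have "d mod 3 \<in> {0, 1, 2}" "e mod 3 \<in> {0, 1, 2}" by auto
      then have "d mod 3 = 1 \<and> e mod 3 = 1 \<or> d mod 3 = 2 \<and> e mod 3 = 2"
        using * by auto
      then show "d \<in> ?L \<union> ?R"
      proof
        assume "d mod 3 = 1 \<and> e mod 3 = 1"
        then have "d = 3*(d div 3)+1" "e = 3*(e div 3)+1" by presburger+
        then have "(d div 3, e div 3) \<in> F" unfolding F_iff using e by metis
        then show ?thesis using \<open>d = _\<close> by (auto intro!: image_eqI[of _ _ "(d div 3, e div 3)"])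
      next
        assume "d mod 3 = 2 \<and> e mod 3 = 2"
        then have "d = 3*(d div 3)+2" "e = 3*(e div 3)+2" by presburger+
        then have "(d div 3, e div 3) \<in> G" unfolding G_iff using e by metis
        then show ?thesis using \<open>d = _\<close> by (auto intro!: image_eqI[of _ _ "(d div 3, e div 3)"])
      qed
    qed
    show "?L \<union> ?R \<subseteq> ?D" 
    proof safe
      fix n m show "(n, m) \<in> F \<Longrightarrow> 3*n+1 dvd 3*N+1" unfolding F_iff by (metis dvd_triv_left)
      show "(n, m) \<in> G \<Longrightarrow> 3*n+2 dvd 3*N+1" unfolding G_iff by (metis dvd_triv_left)
    qed
  qed
  have inj1: "inj_on (\<lambda>(n,m). 3*n+1) F"
  proof (rule inj_onI, clarify)
    fix n m n' m' assume *: "(n, m) \<in> F" "(n', m') \<in> F" "3*n+1 = 3*n'+1"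
    then have "n' = n" by simp
    with * have "(3*n+1) * (3*m+1) = (3*n'+1) * (3*m'+1)" unfolding F_iff by simp
    with \<open>n' = n\<close> have "(3*n+1) * (3*m+1) = (3*n+1) * (3*m'+1)" by (simp only:)
    then have "3*m+1 = 3*m'+1" by (subst (asm) mult_left_cancel) simp_all
    with \<open>n' = n\<close> show "n = n' \<and> m = m'" by simp
  qed
  have inj2: "inj_on (\<lambda>(n,m). 3*n+2) G"
  proof (rule inj_onI, clarify)
    fix n m n' m' assume *: "(n, m) \<in> G" "(n', m') \<in> G" "3*n+2 = 3*n'+2"
    then have "n' = n" by simp
    with * have "(3*n+2) * (3*m+2) = (3*n'+2) * (3*m'+2)" unfolding G_iff by simp
    with \<open>n' = n\<close> have "(3*n+2) * (3*m+2) = (3*n+2) * (3*m'+2)" by (simp only:)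
    then have "3*m+2 = 3*m'+2" by (subst (asm) mult_left_cancel) simp_all
    with \<open>n' = n\<close> show "n = n' \<and> m = m'" by simp
  qed
  have disj: "?L \<inter> ?R = {}" by (auto; presburger)
  have "(\<Sum>d | d dvd 3*N+1. g d) = sum g ?L + sum g ?R"
    unfolding eq by (rule sum.union_disjoint) (use finF finG disj in auto)
  also have "\<dots> = (\<Sum>z\<in>F. g (3 * fst z + 1)) + (\<Sum>z\<in>G. g (3 * fst z + 2))"
    using sum.reindex[OF inj1, of g] sum.reindex[OF inj2, of g] by (simp add: case_prod_unfold o_def)
  finally show ?thesis by (simp add: F_def G_def case_prod_unfold)
qed

lemma Legendre_3:
  "Legendre (int (3*n+1)) 3 = 1" "Legendre (int (3*n+2)) 3 = - 1"
proof -
  have "[1\<^sup>2 = int (3*n+1)] (mod 3)" by (simp add: cong_def)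
  then have "QuadRes 3 (int (3*n+1))" unfolding QuadRes_def by blast
  moreover have "\<not> [int (3*n+1) = 0] (mod 3)" by (simp add: cong_def)
  ultimately show "Legendre (int (3*n+1)) 3 = 1" by (simp add: Legendre_def)
  have "\<not> QuadRes 3 (int (3*n+2))"
  proof
    assume "QuadRes 3 (int (3*n+2))"
    then obtain y :: int where "y\<^sup>2 mod 3 = (int (3*n+2)) mod 3" by (auto simp: QuadRes_def cong_def)
    then have "(y mod 3)\<^sup>2 mod 3 = 2" by (simp add: power_mod)
    moreover have "y mod 3 \<in> {0,1,2}" by auto
    ultimately show False by auto
  qed
  moreover have "\<not> [int (3*n+2) = 0] (mod 3)" by (simp add: cong_def)
  ultimately show "Legendre (int (3*n+2)) 3 = - 1" by (simp add: Legendre_def)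
qed

section \<open>Double series over factorisations\<close>

text \<open>Each double series is evaluated twice or three times: row by row, column by column, and by
collecting powers of \<open>q\<close>. In the rows and columns of interest the exponent is affine in the running
index, so that they are geometric series or derivatives of such.\<close>

lemma double_sum_rows:
  fixes q :: complex
  assumes q: "norm q < 1" and h: "\<And>n m. n + m \<le> h n m"
    and w: "\<And>n m. norm (w n m) \<le> real (Suc n) * real (Suc m)"
    and rows: "\<And>n. ((\<lambda>m. w n m * q ^ h n m) has_sum r n) UNIV"
  shows "(r has_sum (\<Sum>\<^sub>\<infinity>(n,m). w n m * q ^ h n m)) UNIV"
proof (rule has_sum_SigmaD)
  show "((\<lambda>(n,m). w n m * q ^ h n m) has_sum (\<Sum>\<^sub>\<infinity>(n,m). w n m * q ^ h n m)) (UNIV \<times> UNIV)"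
    using has_sum_infsum[OF double_sum_summable[OF q h w]] by simp
  show "((\<lambda>m. case (n, m) of (n, m) \<Rightarrow> w n m * q ^ h n m) has_sum r n) UNIV" for n
    using rows by simp
qed

lemma double_sum_columns:
  fixes q :: complex
  assumes q: "norm q < 1" and h: "\<And>n m. n + m \<le> h n m"
    and w: "\<And>n m. norm (w n m) \<le> real (Suc n) * real (Suc m)"
    and columns: "\<And>m. ((\<lambda>n. w n m * q ^ h n m) has_sum r m) UNIV"
  shows "(r has_sum (\<Sum>\<^sub>\<infinity>(n,m). w n m * q ^ h n m)) UNIV"
proof (rule has_sum_SigmaD)
  show "((\<lambda>(m,n). w n m * q ^ h n m) has_sum (\<Sum>\<^sub>\<infinity>(n,m). w n m * q ^ h n m)) (UNIV \<times> UNIV)"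
  proof -
    have "((\<lambda>(n,m). w n m * q ^ h n m) has_sum (\<Sum>\<^sub>\<infinity>(n,m). w n m * q ^ h n m)) (UNIV \<times> UNIV)"
      using has_sum_infsum[OF double_sum_summable[OF q h w]] by simp
    from iffD1[OF has_sum_swap this] show ?thesis by simp
  qed
  show "((\<lambda>n. case (m, n) of (m, n) \<Rightarrow> w n m * q ^ h n m) has_sum r m) UNIV" for m
    using columns by simp
qed

lemma double_sum_by_exponent:
  fixes q :: complex
  assumes q: "norm q < 1" and h: "\<And>n m. n + m \<le> h n m"
    and w: "\<And>n m. norm (w n m) \<le> real (Suc n) * real (Suc m)"
  shows "(\<lambda>N. (\<Sum>(n,m) | h n m = N. w n m) * q ^ N) sums (\<Sum>\<^sub>\<infinity>(n,m). w n m * q ^ h n m)"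
proof -
  have "((\<lambda>z. (case z of (n,m) \<Rightarrow> w n m) * q ^ (case z of (n,m) \<Rightarrow> h n m)) has_sum
      (\<Sum>\<^sub>\<infinity>(n,m). w n m * q ^ h n m)) UNIV"
    using has_sum_infsum[OF double_sum_summable[OF q h w]] by (simp add: case_prod_unfold)
  from sums_by_exponent[OF this] finite_exponent_fibre[of h, OF h]
  show ?thesis by (simp add: case_prod_unfold)
qed

lemma has_sum_row:
  fixes c :: complex
  assumes "norm c < 1" "\<And>m. q ^ h m = a * c ^ m"
  shows "((\<lambda>m. q ^ h m) has_sum (a / (1 - c))) UNIV"
  using has_sum_cmult_right[OF has_sum_geometric[OF assms(1)], of a] by (simp add: assms(2))

text \<open>The generating functions of the factorisations of \<open>3 * N + 1\<close> into two factors congruent to \<open>1\<close>, and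
into two factors congruent to \<open>2\<close> modulo \<open>3\<close>, where \<open>N\<close> is the exponent of \<open>q\<close>.
The factor \<open>1\<close> is the weight in the general statements about double series above.\<close>

definition sum11 :: "complex \<Rightarrow> complex" where
  "sum11 q = (\<Sum>\<^sub>\<infinity>(n,m). 1 * q ^ (3*n*m+n+m))"
definition sum22 :: "complex \<Rightarrow> complex" where
  "sum22 q = (\<Sum>\<^sub>\<infinity>(n,m). 1 * q ^ (3*n*m+2*n+2*m+1))"

lemma norm_power_lt_1: "norm (q::complex) < 1 \<Longrightarrow> n > 0 \<Longrightarrow> norm (q ^ n) < 1"
  by (simp add: norm_power power_less_one_iff)

lemma norm_one_le_weight: "norm (1::complex) \<le> real (Suc n) * real (Suc m)"
  by (simp add: distrib_left distrib_right)

lemma sum11_rows: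
  assumes q: "norm q < 1"
  shows "((\<lambda>n. q ^ n / (1 - q ^ (3*n+1))) has_sum sum11 q) UNIV"
  unfolding sum11_def
proof (rule double_sum_rows[OF q _ norm_one_le_weight])
  fix n show "((\<lambda>m. 1 * q ^ (3*n*m+n+m)) has_sum (q ^ n / (1 - q ^ (3*n+1)))) UNIV"
    unfolding mult_1 by (rule has_sum_row) (use q in \<open>auto simp: norm_power_lt_1 algebra_simps simp flip: power_mult power_add power_Suc\<close>)
qed simp

lemma sum22_rows:
  assumes q: "norm q < 1"
  shows "((\<lambda>n. q ^ (2*n+1) / (1 - q ^ (3*n+2))) has_sum sum22 q) UNIV"
  unfolding sum22_def
proof (rule double_sum_rows[OF q _ norm_one_le_weight])
  fix n show "((\<lambda>m. 1 * q ^ (3*n*m+2*n+2*m+1)) has_sum (q ^ (2*n+1) / (1 - q ^ (3*n+2)))) UNIV"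
    unfolding mult_1 by (rule has_sum_row) (use q in \<open>auto simp: norm_power_lt_1 algebra_simps simp flip: power_mult power_add power_Suc\<close>)
qed simp

section \<open>The square of the bilateral Lambert series\<close>

lemma powi_ne_1:
  fixes q :: complex
  assumes q: "norm q < 1" "q \<noteq> 0" and k: "k \<noteq> 0"
  shows "q powi k \<noteq> 1"
proof (cases "k > 0")
  case True
  then show ?thesis using power_ne_1[OF q(1), of "nat k"] by (simp add: power_int_def)
next
  case False
  then have "q ^ nat (- k) \<noteq> 1" using power_ne_1[OF q(1), of "nat (- k)"] k by simp
  then show ?thesis using False k by (simp add: power_int_def power_inverse)
qed

lemma one_minus_powi_reflect:
  fixes q :: complex
  assumes q: "q \<noteq> 0"
  shows "1 - q powi (3 * (- 1 - int n) + 1) = - (1 - q ^ (3*n+2)) / q ^ (3*n+2)"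
proof -
  have "3 * (- 1 - int n) + 1 = - int (3*n+2)" by simp
  then have "q powi (3 * (- 1 - int n) + 1) = 1 / q ^ (3*n+2)"
    by (simp only: power_int_minus power_int_of_nat inverse_eq_divide)
  then show ?thesis
    using q by (simp only:) (simp add: field_simps)
qed

text \<open>For \<open>j = 1\<close> these are the terms of the bilateral series with the product formula; for \<open>j = 2\<close> the
series vanishes, which is what makes the square of the first one collapse.\<close>

definition lambert_term :: "complex \<Rightarrow> nat \<Rightarrow> int \<Rightarrow> complex" where
  "lambert_term q j n = q powi (int j * n) / (1 - q powi (3*n+1))"

lemma lambert_term_nonnegative:
  fixes q :: complex
  shows "lambert_term q j (int n) = q ^ (j*n) / (1 - q ^ (3*n+1))"
proof -
  have "int j * int n = int (j*n)" "3 * int n + 1 = int (3*n+1)" by simp_all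
  then show ?thesis unfolding lambert_term_def by (simp only: power_int_of_nat)
qed

text \<open>The exponent \<open>e\<close> is \<open>3 * n + 2 - j * (n + 1)\<close>, described without subtraction. It is \<open>2 * n + 1\<close> for
\<open>j = 1\<close> and \<open>n\<close> for \<open>j = 2\<close>.\<close>

lemma lambert_term_negative_aux:
  fixes q :: complex
  assumes q: "q \<noteq> 0" 
  shows "lambert_term q j (- 1 - int n) * q ^ (j * (n+1)) = - (q ^ (3*n+2)) / (1 - q ^ (3*n+2))"
proof -
  have "q powi (int j * (- 1 - int n)) = 1 / q ^ (j * (n+1))"
  proof -
    have "int j * (- 1 - int n) = - int (j * (n+1))" by (simp add: algebra_simps)
    then show ?thesis by (simp only: power_int_minus power_int_of_nat inverse_eq_divide)
  qed
  then have "lambert_term q j (- 1 - int n) * q ^ (j * (n+1)) =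
      1 / q ^ (j * (n+1)) / (- (1 - q ^ (3*n+2)) / q ^ (3*n+2)) * q ^ (j * (n+1))"
    by (simp only: lambert_term_def one_minus_powi_reflect[OF q])
  also have "\<dots> = - (q ^ (3*n+2)) / (1 - q ^ (3*n+2))"
  proof -
    have *: "1 / y / (- (1 - x) / x) * y = - x / (1 - x)" if "y \<noteq> 0" for x y :: complex
      using that by (simp add: divide_simps) (simp add: right_diff_distrib)
    show ?thesis by (rule *) (use q in simp)
  qed
  finally show ?thesis .
qed

lemma lambert_term_negative:
  fixes q :: complex
  assumes q: "q \<noteq> 0" and e: "e + j * (n+1) = 3*n+2"
  shows "lambert_term q j (- 1 - int n) = - (q ^ e) / (1 - q ^ (3*n+2))"
proof -
  have "q ^ e * q ^ (j * (n+1)) = q ^ (3*n+2)" unfolding e[symmetric] power_add ..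
  then have "lambert_term q j (- 1 - int n) * q ^ (j * (n+1)) = (- (q ^ e) / (1 - q ^ (3*n+2))) * q ^ (j * (n+1))"
    unfolding lambert_term_negative_aux[OF q] by simp
  then show ?thesis by (rule mult_right_cancel[THEN iffD1, rotated]) (use q in simp)
qed

text \<open>The reflection \<open>n \<mapsto> - 1 - n\<close> turns the terms with negative index into those of the expansion
of \<open>sum22\<close> by rows, with the opposite sign.\<close>

lemma lambert_term_1_has_sum:
  assumes q: "norm q < 1" "q \<noteq> 0"
  shows "(lambert_term q 1 has_sum (sum11 q - sum22 q)) UNIV"
proof -
  have "((\<lambda>n. lambert_term q 1 (int n)) has_sum sum11 q) UNIV"
    using sum11_rows[OF q(1)] by (simp only: lambert_term_nonnegative mult_1)
  moreover have "lambert_term q 1 (- 1 - int n) = - (q ^ (2*n+1) / (1 - q ^ (3*n+2)))" for n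
    using lambert_term_negative[OF q(2), of "2*n+1" 1 n] by simp
  then have "((\<lambda>n. lambert_term q 1 (- 1 - int n)) has_sum (- sum22 q)) UNIV"
    using sum22_rows[OF q(1)] by (simp only: has_sum_uminus minus_minus)
  ultimately show ?thesis using has_sum_int_halves by fastforce
qed

text \<open>The two halves of this series are the row and the column expansion of one and the same double
series, the generating function of the factorisations of \<open>3 * N + 2\<close>, with opposite signs. It is
the same antisymmetry that makes the divisor sums of the Legendre symbol over \<open>3 * N + 2\<close> vanish.\<close>

lemma lambert_term_2_has_sum_0:
  assumes q: "norm q < 1" "q \<noteq> 0"
  shows "(lambert_term q 2 has_sum 0) UNIV"
proof -
  define T where "T = (\<Sum>\<^sub>\<infinity>(n,m). 1 * q ^ (3*n*m+2*n+m))"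
  have "((\<lambda>n. q ^ (2*n) / (1 - q ^ (3*n+1))) has_sum T) UNIV"
    unfolding T_def
  proof (rule double_sum_rows[OF q(1) _ norm_one_le_weight])
    fix n show "((\<lambda>m. 1 * q ^ (3*n*m+2*n+m)) has_sum (q ^ (2*n) / (1 - q ^ (3*n+1)))) UNIV"
      unfolding mult_1 by (rule has_sum_row) (use q in \<open>auto simp: norm_power_lt_1 algebra_simps simp flip: power_mult power_add power_Suc\<close>)
  qed simp
  then have "((\<lambda>n. lambert_term q 2 (int n)) has_sum T) UNIV" by (simp only: lambert_term_nonnegative)
  moreover have "((\<lambda>m. q ^ m / (1 - q ^ (3*m+2))) has_sum T) UNIV"
    unfolding T_def
  proof (rule double_sum_columns[OF q(1) _ norm_one_le_weight])
    fix m show "((\<lambda>n. 1 * q ^ (3*n*m+2*n+m)) has_sum (q ^ m / (1 - q ^ (3*m+2)))) UNIV"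
      unfolding mult_1 by (rule has_sum_row) (use q in \<open>auto simp: norm_power_lt_1 algebra_simps simp flip: power_mult power_add power_Suc\<close>)
  qed simp
  moreover have "lambert_term q 2 (- 1 - int n) = - (q ^ n / (1 - q ^ (3*n+2)))" for n
    using lambert_term_negative[OF q(2), of n 2 n] by simp
  ultimately have "(lambert_term q 2 has_sum (T + - T)) UNIV"
    by (intro has_sum_int_halves) (simp_all only: has_sum_uminus minus_minus)
  then show ?thesis by simp
qed

text \<open>The nonnegative indices contribute \<open>m + 1\<close> and the negative ones \<open>n\<close> to the coefficient belonging to
the factorisation \<open>(3 * n + 1) * (3 * m + 2)\<close>.\<close>

lemma lambert_term_square_has_sum:
  assumes q: "norm q < 1" "q \<noteq> 0"
  shows "((\<lambda>n. (lambert_term q 1 n)\<^sup>2) has_sum (\<Sum>\<^sub>\<infinity>(n,m). of_nat (n+m+1) * q ^ (3*n*m+2*n+m))) UNIV"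
proof -
  define T1 where "T1 = (\<Sum>\<^sub>\<infinity>(n,m). of_nat (Suc m) * q ^ (3*n*m+2*n+m))"
  define T2 where "T2 = (\<Sum>\<^sub>\<infinity>(n,m). of_nat n * q ^ (3*n*m+2*n+m))"
  have wm: "norm (of_nat (Suc m) :: complex) \<le> real (Suc n) * real (Suc m)" for n m
    unfolding norm_of_nat by (simp add: distrib_left distrib_right)
  have wn: "norm (of_nat n :: complex) \<le> real (Suc n) * real (Suc m)" for n m
    unfolding norm_of_nat by (simp add: distrib_left distrib_right)
  have pos: "((\<lambda>n. (lambert_term q 1 (int n))\<^sup>2) has_sum T1) UNIV"
    unfolding T1_def
  proof (rule double_sum_rows[OF q(1) _ wm])
    fix n
    have "((\<lambda>m. q ^ (2*n) * (of_nat (Suc m) * (q ^ (3*n+1)) ^ m)) has_sum (q ^ (2*n) * (1 / (1 - q ^ (3*n+1))\<^sup>2))) UNIV"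
      by (intro has_sum_cmult_right has_sum_Suc_geometric norm_power_lt_1 q) simp
    moreover have "q ^ (2*n) * (of_nat (Suc m) * (q ^ (3*n+1)) ^ m) = of_nat (Suc m) * q ^ (3*n*m+2*n+m)" for m
    proof -
      have "q ^ (2*n) * (q ^ (3*n+1)) ^ m = q ^ (3*n*m+2*n+m)"
        by (simp add: algebra_simps flip: power_mult power_add power_Suc)
      then show ?thesis by (simp add: mult_ac)
    qed
    moreover have "q ^ (2*n) * (1 / (1 - q ^ (3*n+1))\<^sup>2) = (lambert_term q 1 (int n))\<^sup>2"
      unfolding lambert_term_nonnegative by (simp add: power_divide mult.commute flip: power_mult)
    ultimately show "((\<lambda>m. of_nat (Suc m) * q ^ (3*n*m+2*n+m)) has_sum (lambert_term q 1 (int n))\<^sup>2) UNIV"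
      by (simp only:)
  qed simp
  have neg: "((\<lambda>m. (lambert_term q 1 (- 1 - int m))\<^sup>2) has_sum T2) UNIV"
    unfolding T2_def
  proof (rule double_sum_columns[OF q(1) _ wn])
    fix m
    have "((\<lambda>n. q ^ m * (of_nat n * (q ^ (3*m+2)) ^ n)) has_sum (q ^ m * (q ^ (3*m+2) / (1 - q ^ (3*m+2))\<^sup>2))) UNIV"
      by (intro has_sum_cmult_right has_sum_index_geometric norm_power_lt_1 q) simp
    moreover have "q ^ m * (of_nat n * (q ^ (3*m+2)) ^ n) = of_nat n * q ^ (3*n*m+2*n+m)" for n
    proof -
      have "q ^ m * (q ^ (3*m+2)) ^ n = q ^ (3*n*m+2*n+m)"
        by (simp add: algebra_simps flip: power_mult power_add power_Suc)
      then show ?thesis by (simp add: mult_ac)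
    qed
    moreover have "q ^ m * (q ^ (3*m+2) / (1 - q ^ (3*m+2))\<^sup>2) = (lambert_term q 1 (- 1 - int m))\<^sup>2"
    proof -
      have "q ^ m * q ^ (3*m+2) = (q ^ (2*m+1))\<^sup>2"
        unfolding power_mult[symmetric] power_add[symmetric] by (rule arg_cong[where f="power q"]) simp
      moreover have "lambert_term q 1 (- 1 - int m) = - (q ^ (2*m+1)) / (1 - q ^ (3*m+2))"
        using lambert_term_negative[OF q(2), of "2*m+1" 1 m] by simp
      ultimately show ?thesis by (simp only: power_divide times_divide_eq_right power2_minus)
    qed
    ultimately show "((\<lambda>n. of_nat n * q ^ (3*n*m+2*n+m)) has_sum (lambert_term q 1 (- 1 - int m))\<^sup>2) UNIV"
      by (simp only:)
  qed simp
  have "T1 + T2 = (\<Sum>\<^sub>\<infinity>z. (case z of (n,m) \<Rightarrow> of_nat (Suc m) * q ^ (3*n*m+2*n+m)) + (case z of (n,m) \<Rightarrow> of_nat n * q ^ (3*n*m+2*n+m)))"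
    unfolding T1_def T2_def
    by (rule infsum_add[symmetric]; rule double_sum_summable[OF q(1)]) (use wm wn in auto)
  also have "\<dots> = (\<Sum>\<^sub>\<infinity>(n,m). of_nat (n+m+1) * q ^ (3*n*m+2*n+m))"
    by (rule infsum_cong) (auto simp: algebra_simps)
  finally show ?thesis using has_sum_int_halves[OF pos neg] by simp
qed

text \<open>With \<open>y = q powi (3*n+1)\<close> and \<open>x = q powi (3*(n+k)+1)\<close>, this is the partial fraction decomposition
\<open>1 / ((1-x) * (1-y)) = (x / (1-x) - y / (1-y)) / (x - y)\<close>. The denominator \<open>x - y\<close> is
\<open>y * (q powi (3*k) - 1)\<close>, so that for fixed \<open>k\<close> only terms of the vanishing series with \<open>j = 2\<close> and
factors independent of \<open>n\<close> remain.\<close>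

lemma lambert_term_product:
  assumes q: "norm q < 1" "q \<noteq> 0" and k: "k \<noteq> 0"
  shows "lambert_term q 1 (n + k) * lambert_term q 1 n =
    (q powi (2*k) * lambert_term q 2 (n + k) - q powi k * lambert_term q 2 n) / (q powi (3*k) - 1)"
proof -
  define Q where "Q = q powi n"
  define R where "R = q powi k"
  have nz: "Q \<noteq> 0" "R \<noteq> 0" using q by (auto simp: Q_def R_def)
  have c: "q powi (3 * i) = (q powi i) ^ 3" "q powi (2 * i) = (q powi i)\<^sup>2" for i
    by (metis mult.commute power_int_mult power_int_numeral)+
  have a1: "lambert_term q 1 n = Q / (1 - Q^3 * q)" "lambert_term q 2 n = Q\<^sup>2 / (1 - Q^3 * q)"
    using q by (simp_all add: lambert_term_def Q_def power_int_add c)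
  have a2: "lambert_term q 1 (n+k) = Q * R / (1 - Q^3 * R^3 * q)" "lambert_term q 2 (n+k) = Q\<^sup>2 * R\<^sup>2 / (1 - Q^3 * R^3 * q)"
    using q by (simp_all add: lambert_term_def Q_def R_def power_int_add c distrib_left power_mult_distrib del: distrib_left_numeral)
  have "q powi (3*n+1) \<noteq> 1" "q powi (3*(n+k)+1) \<noteq> 1" "q powi (3*k) \<noteq> 1"
    using k by (intro powi_ne_1[OF q]; presburger)+
  then have "1 - Q^3 * q \<noteq> 0" "1 - Q^3 * R^3 * q \<noteq> 0" "R^3 - 1 \<noteq> 0"
    using q by (simp_all add: Q_def R_def power_int_add c power_mult_distrib distrib_left del: distrib_left_numeral)
  then show ?thesis
    unfolding a1 a2 c R_def[symmetric]
    by (simp add: divide_simps) (simp add: algebra_simps power2_eq_square power3_eq_cube)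
qed

text \<open>The terms of the squared series are grouped along the diagonals \<open>m = n + k\<close>. By
\<open>lambert_term_product\<close>, every diagonal with \<open>k \<noteq> 0\<close> sums to a combination of two copies of the
vanishing series, and only the main diagonal survives.\<close>

lemma lambert_series_square:
  assumes q: "norm q < 1" "q \<noteq> 0" and s: "(lambert_term q 1 has_sum s) UNIV"
    and t: "((\<lambda>n. (lambert_term q 1 n)\<^sup>2) has_sum t) UNIV"
  shows "s\<^sup>2 = t"
proof -
  have "((\<lambda>(m,n). lambert_term q 1 m * lambert_term q 1 n) has_sum (s * s)) (UNIV \<times> UNIV)"
    by (rule has_sum_product_complex[OF s s])
  moreover have "bij_betw (\<lambda>(k,n). (n + k, n)) (UNIV \<times> UNIV) (UNIV \<times> (UNIV :: int set))"
    by (rule bij_betwI[of _ _ _ "\<lambda>(m,n). (m - n, n)"]) auto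
  ultimately have "((\<lambda>(k,n). lambert_term q 1 (n + k) * lambert_term q 1 n) has_sum (s * s)) (UNIV \<times> UNIV)"
    using has_sum_reindex_bij_betw[of "\<lambda>(k,n). (n + k, n)" "UNIV \<times> UNIV" "UNIV \<times> UNIV" "\<lambda>(m,n). lambert_term q 1 m * lambert_term q 1 n" "s * s"]
    by (simp add: case_prod_unfold)
  then have "((\<lambda>k::int. if k = 0 then t else 0) has_sum (s * s)) UNIV"
  proof (rule has_sum_SigmaD)
    fix k :: int
    have sh: "((\<lambda>n. lambert_term q 2 (n + k)) has_sum 0) UNIV"
      using lambert_term_2_has_sum_0[OF q] has_sum_reindex_bij_betw[of "\<lambda>n. n + k" UNIV UNIV "lambert_term q 2" 0]
      by (simp add: bij_plus_right)
    show "((\<lambda>n. case (k, n) of (k, n) \<Rightarrow> lambert_term q 1 (n + k) * lambert_term q 1 n) has_sum (if k = 0 then t else 0)) UNIV"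
    proof (cases "k = 0")
      case True
      then show ?thesis using t by (simp add: power2_eq_square)
    next
      case False
      have "((\<lambda>n. (q powi (2*k) * lambert_term q 2 (n + k) + - (q powi k) * lambert_term q 2 n) * (1 / (q powi (3*k) - 1))) has_sum
         ((q powi (2*k) * 0 + - (q powi k) * 0) * (1 / (q powi (3*k) - 1)))) UNIV"
        by (intro has_sum_cmult_left has_sum_cmult_right has_sum_add sh lambert_term_2_has_sum_0 q)
      then show ?thesis unfolding prod.case lambert_term_product[OF q False] using False by simp
    qed
  qed
  moreover have "((\<lambda>k::int. if k = 0 then t else 0) has_sum t) (UNIV :: int set)"
    using has_sum_finite[of "{0::int}" "\<lambda>k. if k = 0 then t else 0"]
    by (subst has_sum_cong_neutral[of "{0}" UNIV _ "\<lambda>k. if k = 0 then t else 0"]) auto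
  ultimately show ?thesis using has_sum_unique by (metis power2_eq_square)
qed

section \<open>The three generating functions\<close>

lemma sum11_minus_sum22:
  assumes q: "norm q < 1" "q \<noteq> 0"
  shows "sum11 q - sum22 q = qq_inf (q ^ 3) ^ 3 / qq_inf q"
proof -
  have "(\<lambda>n. q ^ n / (1 - q ^ (3*n+1)) - q ^ (2*n+1) / (1 - q ^ (3*n+2))) sums (sum11 q - sum22 q)"
    by (intro sums_diff has_sum_imp_sums sum11_rows sum22_rows q)
  then show ?thesis using bilateral_sum_eq_eta_quotient[OF q] sums_unique2 by blast
qed

lemma Legendre_divisor_sum_sums:
  assumes q: "norm q < 1"
  shows "(\<lambda>n. of_int (\<Sum>d | d dvd 3 * n + 1. Legendre (int d) 3) * q ^ n) sums (sum11 q - sum22 q)"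
proof -
  have "(\<lambda>N. (\<Sum>(n,m) | 3*n*m+n+m = N. 1) * q ^ N - (\<Sum>(n,m) | 3*n*m+2*n+2*m+1 = N. 1) * q ^ N)
      sums (sum11 q - sum22 q)"
    unfolding sum11_def sum22_def by (intro sums_diff double_sum_by_exponent q norm_one_le_weight) auto
  moreover have "complex_of_int (\<Sum>d | d dvd 3*N+1. Legendre (int d) 3) =
      (\<Sum>(n,m) | 3*n*m+n+m = N. 1) - (\<Sum>(n,m) | 3*n*m+2*n+2*m+1 = N. 1)" for N
    unfolding divisor_sum_3n1 Legendre_3 by (simp add: sum_negf case_prod_unfold)
  ultimately show ?thesis by (simp only: left_diff_distrib)
qed

text \<open>The two divisors \<open>3 * n + 1\<close> and \<open>3 * m + 2\<close> belonging to a factorisation add up to \<open>3 * (n + m + 1)\<close>.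
This is the source of the factor \<open>3\<close> in the first identity.\<close>

lemma sigma_divisor_sum_sums:
  fixes q :: complex
  assumes q: "norm q < 1"
  shows "(\<lambda>n. of_nat (\<Sum>d | d dvd 3 * n + 2. d) * q ^ n) sums
    (3 * (\<Sum>\<^sub>\<infinity>(n,m). of_nat (n+m+1) * q ^ (3*n*m+2*n+m)))"
proof -
  have w: "norm (of_nat (n+m+1) :: complex) \<le> real (Suc n) * real (Suc m)" for n m
    unfolding norm_of_nat by (simp add: distrib_left distrib_right)
  have "(\<lambda>N. 3 * ((\<Sum>(n,m) | 3*n*m+2*n+m = N. of_nat (n+m+1)) * q ^ N)) sums
      (3 * (\<Sum>\<^sub>\<infinity>(n,m). of_nat (n+m+1) * q ^ (3*n*m+2*n+m)))"
    by (intro sums_mult double_sum_by_exponent q w) auto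
  moreover have "complex_of_nat (\<Sum>d | d dvd 3*N+2. d) = 3 * (\<Sum>(n,m) | 3*n*m+2*n+m = N. of_nat (n+m+1))" for N
    unfolding divisor_sum_3n2[of "\<lambda>d. d"] of_nat_sum sum_distrib_left by (rule sum.cong) auto
  ultimately show ?thesis by (simp only: mult.assoc)
qed

lemma sum_Legendre_3n2: "(\<Sum>d | d dvd 3*n+2. Legendre (int d) 3) = 0"
  unfolding divisor_sum_3n2 Legendre_3 by simp

theorem theorem2p2:
  fixes q :: complex
  assumes "norm q < 1"
  shows "(\<lambda>n. of_nat (\<Sum>d | d dvd 3 * n + 2. d) * q ^ n) sums
           (3 * qq_inf (q ^ 3) ^ 6 / qq_inf q ^ 2) \<and>
         (\<lambda>n. of_int (\<Sum>d | d dvd 3 * n + 1. Legendre (int d) 3) * q ^ n) sums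
           (qq_inf (q ^ 3) ^ 3 / qq_inf q) \<and>
         (\<lambda>n. of_int (\<Sum>d | d dvd 3 * n + 2. Legendre (int d) 3) * q ^ n) sums 0"
proof (cases "q = 0")
  case True
  \<comment> \<open>All three series reduce to their constant terms. This case is separate because \<open>q powi n\<close> is not meaningful for negative \<open>n\<close> there.\<close>
  have dvd2: "{d. d dvd (2::nat)} = {1, 2}" using two_is_prime_nat by (auto simp: prime_nat_iff)
  have dvd1: "{d. d dvd (1::nat)} = {1}" by auto
  have index_0: "3 * 0 + 2 = (2::nat)" "3 * 0 + 1 = (1::nat)" by simp_all
  have Leg1: "Legendre (int 1) 3 = 1" using Legendre_3(1)[of 0] by simp
  have c2: "complex_of_nat (\<Sum>d | d dvd 3 * 0 + 2. d) = 3" unfolding index_0 dvd2 by simp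
  have c1: "complex_of_int (\<Sum>d | d dvd 3 * 0 + 1. Legendre (int d) 3) = 1"
    unfolding index_0 dvd1 using Leg1 by simp
  have qq1: "qq_inf (0 ^ 3) = 1" "qq_inf 0 = 1" by (simp_all add: qq_inf_def)
  show ?thesis
    unfolding True qq1 sum_Legendre_3n2
    using powser_sums_zero[of "\<lambda>n. of_nat (\<Sum>d | d dvd 3 * n + 2. d) :: complex"]
      powser_sums_zero[of "\<lambda>n. of_int (\<Sum>d | d dvd 3 * n + 1. Legendre (int d) 3) :: complex"]
    unfolding c1 c2 by simp
next
  case False
  note q = assms False
  have "(sum11 q - sum22 q)\<^sup>2 = (\<Sum>\<^sub>\<infinity>(n,m). of_nat (n+m+1) * q ^ (3*n*m+2*n+m))"
    by (rule lambert_series_square[OF q lambert_term_1_has_sum[OF q] lambert_term_square_has_sum[OF q]])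
  moreover have "(sum11 q - sum22 q)\<^sup>2 = qq_inf (q ^ 3) ^ 6 / qq_inf q ^ 2"
    unfolding sum11_minus_sum22[OF q] by (simp add: power_divide flip: power_mult)
  ultimately have "3 * (\<Sum>\<^sub>\<infinity>(n,m). of_nat (n+m+1) * q ^ (3*n*m+2*n+m)) =
      3 * qq_inf (q ^ 3) ^ 6 / qq_inf q ^ 2"
    by (simp only: times_divide_eq_right[symmetric])
  then show ?thesis
    using sigma_divisor_sum_sums[OF assms] Legendre_divisor_sum_sums[OF assms]
    unfolding sum11_minus_sum22[OF q] sum_Legendre_3n2 by simp
qed

end
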